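(* Let $\theta_0,\theta_\infty\in\mathbb C$ with corresponding $w\in\mathscr W_{\mathrm{IV}}\setminus\mathscr W_{\mathrm{IV}}^{\operatorname{sing}}$ and, with the notation of the context, let $M$ be the variety of Stokes multipliers, with quotient map $M\to\mathcal M_w$. The lines $L_1,\dots,L_{12}$ on $\mathcal M_w$ correspond to the following subsets of $M$: \begin{align*} L_1&:\{s_2+e^{2\pi i(\theta_\infty-\theta_0)}s_4=0,\ 1+s_1s_2=e^{-2\pi i(\theta_\infty+\theta_0)}\},\\ L_2&:\{s_2+e^{2\pi i(\theta_\infty+\theta_0)}s_4=0,\ 1+s_1s_2=e^{-2\pi i(\theta_\infty-\theta_0)}\},\\ L_3&:\{s_1=0\}\cap M,\\ L_4&:\{s_3+e^{2\pi i(\theta_\infty-\theta_0)}s_1=0,\ 1+s_3s_4=e^{-2\pi i(\theta_\infty+\theta_0)}\},\\ L_5&:\{s_3+e^{2\pi i(\theta_\infty+\theta_0)}s_1=0,\ 1+s_3s_4=e^{-2\pi i(\theta_\infty-\theta_0)}\},\\ L_6&:\{s_4=0\}\cap M,\\ L_7&:\{s_1+e^{-2\pi i(\theta_\infty+\theta_0)}s_3=0,\ 1+s_2s_3=e^{2\pi i(\theta_\infty+\theta_0)}\},\\ L_8&:\{s_1+e^{-2\pi i(\theta_\infty-\theta_0)}s_3=0,\ 1+s_2s_3=e^{2\pi i(\theta_\infty-\theta_0)}\},\\ L_9&:\{s_2=0\}\cap M,\\ L_{10}&:\{s_2+e^{2\pi i(\theta_\infty+\theta_0)}s_4=0,\ 1+s_3s_4=e^{-2\pi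 i(\theta_\infty+\theta_0)}\},\\ L_{11}&:\{s_2+e^{2\pi i(\theta_\infty-\theta_0)}s_4=0,\ 1+s_3s_4=e^{-2\pi i(\theta_\infty-\theta_0)}\},\\ L_{12}&:\{s_3=0\}\cap M. \end{align*} Further, the curves $C_1,\dots,C_4$ on $\mathcal M_w$ correspond to $$C_1:\{s_1s_4+e^{-4\pi i\theta_\infty}=0\}\cap M,\quad C_2:\{s_1s_2+1=0\}\cap M,\quad C_3:\{s_3s_4+1=0\}\cap M,\quad C_4:\{s_2s_3+1=0\}\cap M.$$ From an analytic point of view, they each correspond to a different quantisation condition on the spectral equation $Y_z=AY$, in terms of the column solutions $\Psi_k$: 1. $\Psi_{k+1}=c\,\Psi_{k-1}$ for some $c\in\mathbb C^*$ is equivalent to $s_k=0$, in which case $c=1$, corresponding to the lines $L_3,L_9,L_{12},L_6$ for $k=1,2,3,4$ respectively. 2. $\Psi_{k+2}=c\,\Psi_{k-1}$ for some $c\in\mathbb C^*$ is equivalent to $1+s_ks_{k+1}=0$, in which case $c=s_{k+1}$, corresponding to the curves $C_2,C_4,C_3,C_1$ for $k=1,2,3,4$ respectively. 3. $\Psi_k(e^{-2\pi i}z)=c\,\Psi_k(z)$ for some $c\in\mathbb C^*$ is equivalent to $s_{k+1}+s_{k+3}+s_{k+1}s_{k+2}s_{k+3}=0$, in which case there are two possible values of $c$, namely $c=e^{\pm2\pi i\theta_0}$. The condition $\Psi_k(e^{-2\pi i}z)=e^{2\pi i\theta_0}\Psi_k(z)$ corresponds to the lines $L_{11},L_4,L_2,L_7$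 for $k=1,2,3,4$ respectively, and the condition $\Psi_k(e^{-2\pi i}z)=e^{-2\pi i\theta_0}\Psi_k(z)$ corresponds to the lines $L_{10},L_5,L_1,L_8$ for $k=1,2,3,4$ respectively.
   Context: **Linear problem.** $Y_z=AY$, $A=z\sigma_3+A_0+z^{-1}A_{-1}$, $\sigma_3=\operatorname{diag}(1,-1)$, $A_0,A_{-1}\in\mathfrak{sl}_2(\mathbb C)$, $\operatorname{Spec}A_{-1}=\{\pm\theta_0\}$, $\det A=-(z+t)^2+2\theta_\infty+\mathcal O(z^{-1})$ as $z\to\infty$. Unique formal solution $Y_{\rm form}(z)=P(z)e^{(z^2/2+tz)\sigma_3}z^{-\theta_\infty\sigma_3}$, $P(z)=I+\sum_{n\ge1}z^{-n}U_n=(P_+(z)\ P_-(z))$ (columns $P_\pm$). On the universal cover of $\mathbb C^*$ let $\Sigma_k=\{|\arg z-\frac{(k-1)\pi}{2}|<\frac\pi4\}$, $k\in\mathbb Z$; $Y_k$ is the unique solution with $Y_k\sim Y_{\rm form}$ as $z\to\infty$ in $\Sigma_k\cup\Sigma_{k+1}$; $Y_{k+1}=Y_kS_k$, where $S_k$ is unipotent, lower triangular for $k$ even, upper triangular for $k$ odd, with off-diagonal entry the Stokes multiplier $s_k$. One has $S_{k+4}=D_\infty S_kD_\infty^{-1}$, $D_\infty=e^{2\pi i\theta_\infty\sigma_3}$. $\Psi_k$ is the unique column solution with $\Psi_k\sim P_\pm(z)e^{\pm(z^2/2+tz)}z^{\mp\theta_\infty}$ as $z\to\infty$ in $\Sigma_k\cup\Sigma_{k+1}\cup\Sigma_{k+2}$,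 with sign $\pm1=(-1)^{k+1}$, so that $\Psi_k$ is the common column of $Y_k$ and $Y_{k+1}$, and $\Psi_{k+1}=\Psi_{k-1}+s_k\Psi_k$. **Stokes variety and monodromy surface.** With $v_0=e^{2\pi i\theta_0}$, $v_\infty=e^{2\pi i\theta_\infty/3}$, $M=\operatorname{Spec}\mathbb C[s_1,s_2,s_3,s_4]/(i_v)$, where $i_v=s_1s_2s_3s_4+s_1s_2+s_1s_4+s_3s_4+v_\infty^{-6}s_2s_3-v_\infty^{-3}(v_0+v_0^{-1})+v_\infty^{-6}+1$. The map $M\to\mathcal M_w$ (GIT quotient by $(s_1,s_2,s_3,s_4)\mapsto(c^{-1}s_1,cs_2,c^{-1}s_3,cs_4)$, $c\in\mathbb C^*$) is $x_1=v_\infty^{-2}(1+v_\infty^6s_1s_4)$, $x_2=v_\infty^2(1+s_1s_2)$, $x_3=v_\infty^2(1+s_3s_4)$, $x_4=v_\infty^{-2}(1+s_2s_3)$, where $\mathcal M_w\subset\mathbb A^4$ is $x_2x_3+x_1+x_4=w_1$, $x_1x_4+x_2+x_3=w_2$, with $w_1=v_\infty(v_0+v_0^{-1})+v_\infty^{-2}$, $w_2=v_\infty^{-1}(v_0+v_0^{-1})+v_\infty^2$. $\mathscr W_{\mathrm{IV}}^{\operatorname{sing}}$ is the set of $w\in\mathscr W_{\mathrm{IV}}=\mathbb C^2$ with $\mathcal M_w$ singular (given by $w_1^2w_2^2-4(w_1^3+w_2^3)+18w_1w_2-27=0$). "A curve corresponds to a subset of $M$" means that the subset is the preimage of the curve.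 **Lines and curves.** Let $u_1=v_\infty v_0$, $u_2=v_\infty v_0^{-1}$ and $b_k=u_1,u_2,(u_1u_2)^{-1}$ for $k\equiv1,2,0\pmod3$. Then $L_k$: $x_1=b_k$, $x_2=b_k^{-1}$, $x_3+b_kx_4=w_2-b_k^{-1}$ ($k=1,2,3$); $L_k$: $x_1=b_k$, $x_3=b_k^{-1}$, $x_2+b_kx_4=w_2-b_k^{-1}$ ($k=4,5,6$); $L_k$: $x_4=b_k$, $x_2=b_k^{-1}$, $x_1+b_k^{-1}x_3=w_1-b_k$ ($k=7,8,9$); $L_k$: $x_4=b_k$, $x_3=b_k^{-1}$, $x_1+b_k^{-1}x_2=w_1-b_k$ ($k=10,11,12$). For $j=1,\dots,4$, $C_j=\mathcal M_w\cap\{x_j=0\}$. *)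

theory Defs
  imports
    "HOL-Analysis.Analysis"
    "HOL-Library.Landau_Symbols"
    "HOL-Computational_Algebra.Formal_Laurent_Series"
begin

section \<open>The linear problem\<close>

definition sigma3 :: "complex^2^2" where
  "sigma3 = vector [vector [1, 0], vector [0, -1]]"

definition coeff_matrix :: "complex^2^2 \<Rightarrow> complex^2^2 \<Rightarrow> complex \<Rightarrow> complex^2^2" where
  "coeff_matrix A\<^sub>0 A\<^sub>m z = mat z ** sigma3 + A\<^sub>0 + mat (inverse z) ** A\<^sub>m"

definition eigenvalues :: "complex^2^2 \<Rightarrow> complex set" where
  "eigenvalues B = {l. \<exists>v. v \<noteq> 0 \<and> B *v v = l *s v}"

definition linear_problem ::
  "complex \<Rightarrow> complex \<Rightarrow> complex^2^2 \<Rightarrow> complex^2^2 \<Rightarrow> complex \<Rightarrow> bool" where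
  "linear_problem \<theta>\<^sub>0 \<theta>\<^sub>i A\<^sub>0 A\<^sub>m t \<longleftrightarrow>
     trace A\<^sub>0 = 0 \<and> trace A\<^sub>m = 0 \<and> eigenvalues A\<^sub>m = {\<theta>\<^sub>0, - \<theta>\<^sub>0} \<and>
     (\<lambda>z. det (coeff_matrix A\<^sub>0 A\<^sub>m z) - (- (z + t)\<^sup>2 + 2 * \<theta>\<^sub>i)) \<in> O[at_infinity](\<lambda>z. inverse z)"

text \<open>
  The universal cover of the punctured plane is the complex plane with covering map
  \<open>z = exp \<zeta>\<close>. So \<open>arg z = Im \<zeta>\<close>, \<open>\<bar>z\<bar> = exp (Re \<zeta>)\<close>, \<open>z\<^sup>a = exp (a * \<zeta>)\<close>,
  the point \<open>e\<^bsup>-2\<pi>i\<^esup>z\<close> has coordinate \<open>\<zeta> - 2\<pi>i\<close>, and \<open>y\<^sub>z = A(z) y\<close>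
  becomes \<open>dy/d\<zeta> = z A(z) y\<close>.
\<close>

definition is_solution ::
  "complex^2^2 \<Rightarrow> complex^2^2 \<Rightarrow> (complex \<Rightarrow> complex^2) \<Rightarrow> bool" where
  "is_solution A\<^sub>0 A\<^sub>m y \<longleftrightarrow>
     (\<forall>\<zeta> i. ((\<lambda>\<zeta>. y \<zeta> $ i) has_field_derivative
              exp \<zeta> * (coeff_matrix A\<^sub>0 A\<^sub>m (exp \<zeta>) *v y \<zeta>) $ i) (at \<zeta>))"

text \<open>
  The formal variable \<open>fls_X\<close> stands for \<open>1/z\<close>, so that \<open>d/dz\<close> is
  \<open>- fls_X\<^sup>2 * fls_deriv\<close>. The series \<open>P = I + \<Sum>n\<ge>1. U n * z\<^sup>-\<^sup>n\<close> gives the formal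
  solution \<open>P exp((z\<^sup>2/2 + t z)\<sigma>\<^sub>3) z\<^bsup>-\<theta>\<sigma>\<^sub>3\<^esup>\<close> iff
  \<open>P' + P (z + t - \<theta>/z) \<sigma>\<^sub>3 = A P\<close>.
\<close>

definition formal_series :: "(nat \<Rightarrow> complex^2^2) \<Rightarrow> complex fls^2^2" where
  "formal_series U = (\<chi> i j. fps_to_fls (Abs_fps (\<lambda>n. U n $ i $ j)))"

definition is_formal_solution ::
  "complex \<Rightarrow> complex^2^2 \<Rightarrow> complex^2^2 \<Rightarrow> complex \<Rightarrow> (nat \<Rightarrow> complex^2^2) \<Rightarrow> bool" where
  "is_formal_solution \<theta>\<^sub>i A\<^sub>0 A\<^sub>m t U \<longleftrightarrow>
     U 0 = mat 1 \<and>
     (let P = formal_series U; C = map_matrix fls_const in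
      map_matrix (\<lambda>f. - (fls_X ^ 2 * fls_deriv f)) P
        + P ** mat (fls_X_inv + fls_const t - fls_const \<theta>\<^sub>i * fls_X) ** C sigma3
      = (mat fls_X_inv ** C sigma3 + C A\<^sub>0 + mat fls_X ** C A\<^sub>m) ** P)"

definition sector :: "int \<Rightarrow> complex set" where
  "sector k = {\<zeta>. \<bar>Im \<zeta> - (of_int k - 1) * pi / 2\<bar> < pi / 4}"

text \<open>
  Poincare asymptotics \<open>f \<sim> \<Sum>n. c n * z\<^sup>-\<^sup>n\<close> as \<open>z \<rightarrow> \<infinity>\<close> in \<open>S\<close>: uniformly on every closed
  subsector \<open>\<alpha> \<le> arg z \<le> \<beta>\<close> contained in \<open>S\<close>.
\<close>

definition has_expansion ::
  "(complex \<Rightarrow> complex) \<Rightarrow> (nat \<Rightarrow> complex) \<Rightarrow> complex set \<Rightarrow> bool" where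
  "has_expansion f c S \<longleftrightarrow>
     (\<forall>\<alpha> \<beta>. {\<zeta>. Im \<zeta> \<in> {\<alpha>..\<beta>}} \<subseteq> S \<longrightarrow>
        (\<forall>N. (\<lambda>\<zeta>. f \<zeta> - (\<Sum>n<N. c n * inverse (exp \<zeta>) ^ n))
              \<in> O[inf (filtercomap Re at_top) (principal {\<zeta>. Im \<zeta> \<in> {\<alpha>..\<beta>}})](\<lambda>\<zeta>. inverse (exp \<zeta>) ^ N)))"

text \<open>
  \<open>y \<sim> P\<^sub>\<plusminus>(z) exp(\<plusminus>(z\<^sup>2/2 + t z)) z\<^bsup>\<mp>\<theta>\<^esup>\<close>, where the column index
  \<open>j = 1\<close> selects the upper sign and \<open>j = 2\<close> the lower one; the sign is \<open>sigma3 $ j $ j\<close>.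
\<close>

definition asymptotic_to_column ::
  "complex \<Rightarrow> complex \<Rightarrow> (nat \<Rightarrow> complex^2^2) \<Rightarrow> complex set \<Rightarrow> 2 \<Rightarrow>
   (complex \<Rightarrow> complex^2) \<Rightarrow> bool" where
  "asymptotic_to_column \<theta>\<^sub>i t U S j y \<longleftrightarrow>
     (\<forall>i. has_expansion
        (\<lambda>\<zeta>. y \<zeta> $ i * exp (- (sigma3 $ j $ j) * (exp \<zeta> ^ 2 / 2 + t * exp \<zeta> - \<theta>\<^sub>i * \<zeta>)))
        (\<lambda>n. U n $ i $ j) S)"

definition is_canonical_solution ::
  "complex \<Rightarrow> complex^2^2 \<Rightarrow> complex^2^2 \<Rightarrow> complex \<Rightarrow> (nat \<Rightarrow> complex^2^2) \<Rightarrow> int \<Rightarrow>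
   (complex \<Rightarrow> complex^2^2) \<Rightarrow> bool" where
  "is_canonical_solution \<theta>\<^sub>i A\<^sub>0 A\<^sub>m t U k Y \<longleftrightarrow>
     (\<forall>j. is_solution A\<^sub>0 A\<^sub>m (\<lambda>\<zeta>. column j (Y \<zeta>)) \<and>
          asymptotic_to_column \<theta>\<^sub>i t U (sector k \<union> sector (k + 1)) j (\<lambda>\<zeta>. column j (Y \<zeta>)))"

definition is_column_solution ::
  "complex \<Rightarrow> complex^2^2 \<Rightarrow> complex^2^2 \<Rightarrow> complex \<Rightarrow> (nat \<Rightarrow> complex^2^2) \<Rightarrow> int \<Rightarrow>
   (complex \<Rightarrow> complex^2) \<Rightarrow> bool" where
  "is_column_solution \<theta>\<^sub>i A\<^sub>0 A\<^sub>m t U k \<psi> \<longleftrightarrow>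
     is_solution A\<^sub>0 A\<^sub>m \<psi> \<and>
     asymptotic_to_column \<theta>\<^sub>i t U (sector k \<union> sector (k + 1) \<union> sector (k + 2))
       (if odd k then 1 else 2) \<psi>"

definition stokes_matrix :: "int \<Rightarrow> complex \<Rightarrow> complex^2^2" where
  "stokes_matrix k a =
     (if even k then vector [vector [1, 0], vector [a, 1]]
      else vector [vector [1, a], vector [0, 1]])"

text \<open>
  All objects attached to a linear problem: the coefficients \<open>U\<close> of the formal solution,
  the canonical solutions \<open>Y k\<close>, the column solutions \<open>\<Psi> k\<close> and the Stokes multipliers \<open>s k\<close>.
\<close>

definition stokes_data ::
  "complex \<Rightarrow> complex \<Rightarrow> complex^2^2 \<Rightarrow> complex^2^2 \<Rightarrow> complex \<Rightarrow> (nat \<Rightarrow> complex^2^2) \<Rightarrow>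
   (int \<Rightarrow> complex \<Rightarrow> complex^2^2) \<Rightarrow> (int \<Rightarrow> complex \<Rightarrow> complex^2) \<Rightarrow> (int \<Rightarrow> complex) \<Rightarrow> bool" where
  "stokes_data \<theta>\<^sub>0 \<theta>\<^sub>i A\<^sub>0 A\<^sub>m t U Y \<Psi> s \<longleftrightarrow>
     linear_problem \<theta>\<^sub>0 \<theta>\<^sub>i A\<^sub>0 A\<^sub>m t \<and>
     is_formal_solution \<theta>\<^sub>i A\<^sub>0 A\<^sub>m t U \<and>
     (\<forall>k. is_canonical_solution \<theta>\<^sub>i A\<^sub>0 A\<^sub>m t U k (Y k)) \<and>
     (\<forall>k. is_column_solution \<theta>\<^sub>i A\<^sub>0 A\<^sub>m t U k (\<Psi> k)) \<and>
     (\<forall>k \<zeta>. Y (k + 1) \<zeta> = Y k \<zeta> ** stokes_matrix k (s k))"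

section \<open>Stokes variety and monodromy surface\<close>

type_synonym point4 = "complex \<times> complex \<times> complex \<times> complex"

definition v_zero :: "complex \<Rightarrow> complex" where
  "v_zero \<theta>\<^sub>0 = exp (2 * pi * \<i> * \<theta>\<^sub>0)"

definition v_inf :: "complex \<Rightarrow> complex" where
  "v_inf \<theta>\<^sub>i = exp (2 * pi * \<i> * \<theta>\<^sub>i / 3)"

definition stokes_variety :: "complex \<Rightarrow> complex \<Rightarrow> point4 set" where
  "stokes_variety \<theta>\<^sub>0 \<theta>\<^sub>i = (let v0 = v_zero \<theta>\<^sub>0; v = v_inf \<theta>\<^sub>i in
     {(s1, s2, s3, s4).
        s1 * s2 * s3 * s4 + s1 * s2 + s1 * s4 + s3 * s4 + s2 * s3 / v ^ 6
        - (v0 + inverse v0) / v ^ 3 + 1 / v ^ 6 + 1 = 0})"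

definition to_surface :: "complex \<Rightarrow> point4 \<Rightarrow> point4" where
  "to_surface \<theta>\<^sub>i = (\<lambda>(s1, s2, s3, s4). let v = v_inf \<theta>\<^sub>i in
     ((1 + v ^ 6 * s1 * s4) / v\<^sup>2, v\<^sup>2 * (1 + s1 * s2), v\<^sup>2 * (1 + s3 * s4), (1 + s2 * s3) / v\<^sup>2))"

definition w_param :: "complex \<Rightarrow> complex \<Rightarrow> complex \<times> complex" where
  "w_param \<theta>\<^sub>0 \<theta>\<^sub>i = (let v0 = v_zero \<theta>\<^sub>0; v = v_inf \<theta>\<^sub>i in
     (v * (v0 + inverse v0) + 1 / v\<^sup>2, (v0 + inverse v0) / v + v\<^sup>2))"

definition monodromy_surface :: "complex \<times> complex \<Rightarrow> point4 set" where
  "monodromy_surface w =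
     {(x1, x2, x3, x4). x2 * x3 + x1 + x4 = fst w \<and> x1 * x4 + x2 + x3 = snd w}"

text \<open>Partial derivatives of the two defining polynomials of the surface.\<close>

definition surface_jacobian :: "point4 \<Rightarrow> complex^4^2" where
  "surface_jacobian = (\<lambda>(x1, x2, x3, x4).
     vector [vector [1, x3, x2, 1], vector [x4, 1, 1, x1]])"

definition W_sing :: "(complex \<times> complex) set" where
  "W_sing = {w. \<exists>x \<in> monodromy_surface w. rank (surface_jacobian x) < 2}"

text \<open>
  A curve on the surface corresponds to its preimage in the Stokes variety.
\<close>

definition preimage :: "complex \<Rightarrow> complex \<Rightarrow> point4 set \<Rightarrow> point4 set" where
  "preimage \<theta>\<^sub>0 \<theta>\<^sub>i X = {s \<in> stokes_variety \<theta>\<^sub>0 \<theta>\<^sub>i. to_surface \<theta>\<^sub>i s \<in> X}"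

definition b_coeff :: "complex \<Rightarrow> complex \<Rightarrow> nat \<Rightarrow> complex" where
  "b_coeff \<theta>\<^sub>0 \<theta>\<^sub>i k = (let u1 = v_inf \<theta>\<^sub>i * v_zero \<theta>\<^sub>0; u2 = v_inf \<theta>\<^sub>i / v_zero \<theta>\<^sub>0 in
     if k mod 3 = 1 then u1 else if k mod 3 = 2 then u2 else inverse (u1 * u2))"

text \<open>The lines \<open>L\<^sub>1, \<dots>, L\<^sub>1\<^sub>2\<close>; only \<open>1 \<le> k \<le> 12\<close> is meaningful.\<close>

definition line_L :: "complex \<Rightarrow> complex \<Rightarrow> nat \<Rightarrow> point4 set" where
  "line_L \<theta>\<^sub>0 \<theta>\<^sub>i k = (let c = b_coeff \<theta>\<^sub>0 \<theta>\<^sub>i k; w1 = fst (w_param \<theta>\<^sub>0 \<theta>\<^sub>i); w2 = snd (w_param \<theta>\<^sub>0 \<theta>\<^sub>i) in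
     if k \<in> {1..3} then
       {(x1, x2, x3, x4). x1 = c \<and> x2 = inverse c \<and> x3 + c * x4 = w2 - inverse c}
     else if k \<in> {4..6} then
       {(x1, x2, x3, x4). x1 = c \<and> x3 = inverse c \<and> x2 + c * x4 = w2 - inverse c}
     else if k \<in> {7..9} then
       {(x1, x2, x3, x4). x4 = c \<and> x2 = inverse c \<and> x1 + inverse c * x3 = w1 - c}
     else if k \<in> {10..12} then
       {(x1, x2, x3, x4). x4 = c \<and> x3 = inverse c \<and> x1 + inverse c * x2 = w1 - c}
     else {})"

text \<open>The curves \<open>C\<^sub>1, \<dots>, C\<^sub>4\<close>; only \<open>1 \<le> j \<le> 4\<close> is meaningful.\<close>

definition curve_C :: "complex \<Rightarrow> complex \<Rightarrow> nat \<Rightarrow> point4 set" where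
  "curve_C \<theta>\<^sub>0 \<theta>\<^sub>i j =
     {(x1, x2, x3, x4) \<in> monodromy_surface (w_param \<theta>\<^sub>0 \<theta>\<^sub>i).
        j \<in> {1..4} \<and> [x1, x2, x3, x4] ! (j - 1) = 0}"

end

theory Submission
  imports Defs "HOL-Real_Asymp.Real_Asymp"
begin

text \<open>
  The Wronskian of two solutions is constant because the system is traceless. Evaluated along the
  centre line of a sector, it shows that the recessive solution there is determined by its leading
  asymptotics. Hence \<open>\<Psi>\<^sub>k\<close> is the common column of \<open>Y\<^sub>k\<close> and \<open>Y\<^sub>k\<^sub>+\<^sub>1\<close>, so that
  \<open>\<Psi>\<^sub>k\<^sub>+\<^sub>1 = \<Psi>\<^sub>k\<^sub>-\<^sub>1 + s\<^sub>k \<Psi>\<^sub>k\<close>, and \<open>\<Psi>\<^sub>k(e\<^bsup>-2\<pi>i\<^esup>z)\<close> is a multiple of \<open>\<Psi>\<^sub>k\<^sub>+\<^sub>4\<close>. Every quantisation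
  condition thereby becomes a polynomial identity in the Stokes multipliers, since \<open>\<Psi>\<^sub>k\<close> and
  \<open>\<Psi>\<^sub>k\<^sub>+\<^sub>1\<close> are linearly independent.

  As \<open>z \<rightarrow> 0\<close> the system is a small perturbation of \<open>dy/d\<zeta> = A\<^sub>-\<^sub>1 y\<close>, so the eigenvalues of the
  monodromy around \<open>0\<close> are \<open>e\<^bsup>\<plusminus>2\<pi>i\<theta>\<^sub>0\<^esup>\<close>. Its determinant is \<open>1\<close>, and its trace, computed in the
  basis \<open>\<Psi>\<^sub>0, \<Psi>\<^sub>1\<close>, gives the equation of the Stokes variety.
\<close>

text \<open>The Stokes multipliers are defined at infinity and theta_0 at the origin. To link them
  no local normal form at 0 is constructed: it suffices to follow one solution that a turn around 0
  multiplies by some \<open>l\<close>. On the circle of radius e^x its components along the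
  eigenvectors of the residue return multiplied by exp(-2 pi i theta_0) and exp(2 pi i theta_0), up
  to an error O(e^x) relative to the whole vector; x tending to minus infinity forces
  \<open>l\<close> to be one of the two. Such a solution comes from an eigenvector of the 2 by 2
  monodromy matrix, and with determinant 1 a single eigenvalue fixes the trace.

  On the algebraic side nonsingularity enters as the distinctness of u_1, u_2 and u_3 = 1/(u_1 u_2),
  which permits cancelling a Stokes multiplier from an equation. Two symmetries, v_0 to 1/v_0 and
  the reversal of (s_1, s_2, s_3, s_4), reduce the twelve lines to four computations.\<close>

no_notation fps_nth (infixl "$" 75)

section \<open>Solutions and Wronskians\<close>

definition wronskian :: "complex^2 \<Rightarrow> complex^2 \<Rightarrow> complex" where
  "wronskian u v = u $ 1 * v $ 2 - u $ 2 * v $ 1"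

text \<open>Multiplication by z turns the coefficient matrix into a polynomial in z, with the
  residue as its constant term.\<close>

lemma is_solution_iff:
  "is_solution A\<^sub>0 A\<^sub>m y \<longleftrightarrow>
    (\<forall>\<zeta>. ((\<lambda>\<zeta>. y \<zeta> $ 1) has_field_derivative
             (exp \<zeta> ^ 2 + exp \<zeta> * A\<^sub>0 $ 1 $ 1 + A\<^sub>m $ 1 $ 1) * y \<zeta> $ 1 +
             (exp \<zeta> * A\<^sub>0 $ 1 $ 2 + A\<^sub>m $ 1 $ 2) * y \<zeta> $ 2) (at \<zeta>) \<and>
         ((\<lambda>\<zeta>. y \<zeta> $ 2) has_field_derivative
             (exp \<zeta> * A\<^sub>0 $ 2 $ 1 + A\<^sub>m $ 2 $ 1) * y \<zeta> $ 1 +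
             (- (exp \<zeta> ^ 2) + exp \<zeta> * A\<^sub>0 $ 2 $ 2 + A\<^sub>m $ 2 $ 2) * y \<zeta> $ 2) (at \<zeta>))"
proof -
  have 1: "exp \<zeta> * (coeff_matrix A\<^sub>0 A\<^sub>m (exp \<zeta>) *v y \<zeta>) $ 1 =
      (exp \<zeta> ^ 2 + exp \<zeta> * A\<^sub>0 $ 1 $ 1 + A\<^sub>m $ 1 $ 1) * y \<zeta> $ 1 +
      (exp \<zeta> * A\<^sub>0 $ 1 $ 2 + A\<^sub>m $ 1 $ 2) * y \<zeta> $ 2" for \<zeta>
    by (simp add: coeff_matrix_def sigma3_def matrix_matrix_mult_def matrix_vector_mult_def
        mat_def sum_2 field_simps power2_eq_square)
  have 2: "exp \<zeta> * (coeff_matrix A\<^sub>0 A\<^sub>m (exp \<zeta>) *v y \<zeta>) $ 2 =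
      (exp \<zeta> * A\<^sub>0 $ 2 $ 1 + A\<^sub>m $ 2 $ 1) * y \<zeta> $ 1 +
      (- (exp \<zeta> ^ 2) + exp \<zeta> * A\<^sub>0 $ 2 $ 2 + A\<^sub>m $ 2 $ 2) * y \<zeta> $ 2" for \<zeta>
    by (simp add: coeff_matrix_def sigma3_def matrix_matrix_mult_def matrix_vector_mult_def
        mat_def sum_2 field_simps power2_eq_square)
  show ?thesis
    unfolding is_solution_def forall_2 1 2 ..
qed

lemma is_solution_smult:
  assumes "is_solution A\<^sub>0 A\<^sub>m y" shows "is_solution A\<^sub>0 A\<^sub>m (\<lambda>\<zeta>. c *s y \<zeta>)"
proof -
  have "exp \<zeta> * (coeff_matrix A\<^sub>0 A\<^sub>m (exp \<zeta>) *v (c *s y \<zeta>)) $ i =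
      c * (exp \<zeta> * (coeff_matrix A\<^sub>0 A\<^sub>m (exp \<zeta>) *v y \<zeta>) $ i)" for \<zeta> i
    by (simp add: vector_scalar_commute)
  moreover have "((\<lambda>\<zeta>. c * y \<zeta> $ i) has_field_derivative
      c * (exp \<zeta> * (coeff_matrix A\<^sub>0 A\<^sub>m (exp \<zeta>) *v y \<zeta>) $ i)) (at \<zeta>)" for \<zeta> i
    using assms by (intro DERIV_cmult) (simp add: is_solution_def)
  ultimately show ?thesis
    unfolding is_solution_def by (simp add: mult.left_commute)
qed

lemma is_solution_add:
  assumes "is_solution A\<^sub>0 A\<^sub>m y" "is_solution A\<^sub>0 A\<^sub>m y'"
  shows "is_solution A\<^sub>0 A\<^sub>m (\<lambda>\<zeta>. y \<zeta> + y' \<zeta>)"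
  using assms
  by (auto simp: is_solution_def matrix_vector_right_distrib distrib_left intro!: DERIV_add)

lemma is_solution_translate:
  assumes "is_solution A\<^sub>0 A\<^sub>m y"
  shows "is_solution A\<^sub>0 A\<^sub>m (\<lambda>\<zeta>. y (\<zeta> - 2 * pi * \<i>))"
proof -
  have "exp (\<zeta> - 2 * pi * \<i>) = exp \<zeta>" for \<zeta> :: complex
    by (simp add: exp_diff)
  moreover have "((\<lambda>\<zeta>. y (\<zeta> + - (2 * pi * \<i>)) $ i) has_field_derivative
      exp (\<zeta> - 2 * pi * \<i>) *
        (coeff_matrix A\<^sub>0 A\<^sub>m (exp (\<zeta> - 2 * pi * \<i>)) *v y (\<zeta> - 2 * pi * \<i>)) $ i) (at \<zeta>)" for \<zeta> i
    using assms by (subst DERIV_shift[symmetric]) (simp add: is_solution_def)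
  ultimately show ?thesis
    unfolding is_solution_def by simp
qed

lemma wronskian_constant:
  assumes "trace A\<^sub>0 = 0" "trace A\<^sub>m = 0"
    and "is_solution A\<^sub>0 A\<^sub>m y" "is_solution A\<^sub>0 A\<^sub>m y'"
  shows "wronskian (y \<zeta>) (y' \<zeta>) = wronskian (y \<zeta>') (y' \<zeta>')"
proof -
  have tr: "A\<^sub>0 $ 2 $ 2 = - A\<^sub>0 $ 1 $ 1" "A\<^sub>m $ 2 $ 2 = - A\<^sub>m $ 1 $ 1"
    using assms(1,2) by (simp_all add: trace_def sum_2 eq_neg_iff_add_eq_0 add.commute)
  have "((\<lambda>\<zeta>. wronskian (y \<zeta>) (y' \<zeta>)) has_field_derivative 0) (at \<zeta>)" for \<zeta>
    unfolding wronskian_def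
    using assms(3,4) unfolding is_solution_iff
    by (auto intro!: derivative_eq_intros simp: tr algebra_simps)
  then obtain c where "\<And>\<zeta>. wronskian (y \<zeta>) (y' \<zeta>) = c"
    using has_field_derivative_zero_constant[of UNIV "\<lambda>\<zeta>. wronskian (y \<zeta>) (y' \<zeta>)"]
    by auto
  then show ?thesis by simp
qed

section \<open>Asymptotics at infinity\<close>

text \<open>On this line z^2 is real with sign (-1)^(m-1), so the two exponentials are as far apart
  in size as possible.\<close>

definition ray :: "int \<Rightarrow> real \<Rightarrow> complex" where
  "ray m x = Complex x ((of_int m - 1) * pi / 2)"

definition phase :: "complex \<Rightarrow> complex \<Rightarrow> complex \<Rightarrow> complex" where
  "phase \<theta>\<^sub>i t \<zeta> = exp \<zeta> ^ 2 / 2 + t * exp \<zeta> - \<theta>\<^sub>i * \<zeta>"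

text \<open>The constant \<open>c\<close> is 1 for the normalised solutions; other values arise from
  going around infinity once.\<close>

definition ray_asymptotic ::
  "complex \<Rightarrow> complex \<Rightarrow> int \<Rightarrow> 2 \<Rightarrow> complex \<Rightarrow> (complex \<Rightarrow> complex^2) \<Rightarrow> bool" where
  "ray_asymptotic \<theta>\<^sub>i t m j c y \<longleftrightarrow>
     (\<forall>i. ((\<lambda>x. y (ray m x) $ i * exp (- (sigma3 $ j $ j) * phase \<theta>\<^sub>i t (ray m x)))
             \<longlongrightarrow> (if i = j then c else 0)) at_top)"

text \<open>The column of the formal solution that decays along \<open>ray m\<close>, the centre line of \<open>sector m\<close>.\<close>

definition recessive :: "int \<Rightarrow> 2" where
  "recessive m = (if even m then 1 else 2)"

text \<open>The centre line is itself a closed subsector, with both bounding angles equal, and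
  truncation at order 1 leaves an error O(1/z).\<close>

lemma has_expansion_imp_tendsto_ray:
  assumes "has_expansion f c S" "sector m \<subseteq> S"
  shows "((\<lambda>x. f (ray m x)) \<longlongrightarrow> c 0) at_top"
proof -
  define \<alpha> where "\<alpha> = (of_int m - 1) * pi / 2"
  have "\<zeta> \<in> sector m" if "Im \<zeta> = \<alpha>" for \<zeta>
    by (simp only: sector_def mem_Collect_eq that \<alpha>_def) simp
  then have "{\<zeta>. Im \<zeta> \<in> {\<alpha>..\<alpha>}} \<subseteq> S"
    using assms(2) by fastforce
  then have O: "(\<lambda>\<zeta>. f \<zeta> - (\<Sum>n<1. c n * inverse (exp \<zeta>) ^ n))
      \<in> O[inf (filtercomap Re at_top) (principal {\<zeta>. Im \<zeta> \<in> {\<alpha>..\<alpha>}})](\<lambda>\<zeta>. inverse (exp \<zeta>) ^ 1)"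
    using assms(1) unfolding has_expansion_def by blast
  have "filterlim (ray m) (inf (filtercomap Re at_top) (principal {\<zeta>. Im \<zeta> \<in> {\<alpha>..\<alpha>}})) at_top"
    by (simp add: filterlim_inf filterlim_principal filterlim_filtercomap_iff ray_def \<alpha>_def o_def
        filterlim_ident)
  from landau_o.big.compose[OF O this]
  obtain C where C: "\<forall>\<^sub>F x in at_top. norm (f (ray m x) - c 0) \<le> C * norm (inverse (exp (ray m x)))"
    by (elim landau_o.bigE) simp
  have "((\<lambda>x. C * norm (inverse (exp (ray m x)))) \<longlongrightarrow> 0) at_top"
    unfolding ray_def norm_inverse norm_exp_eq_Re by simp real_asymp
  from Lim_null_comparison[OF C this] show ?thesis
    by (simp add: LIM_zero_iff)
qed

lemma asymptotic_to_column_imp_ray: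
  assumes "asymptotic_to_column \<theta>\<^sub>i t U S j y" "sector m \<subseteq> S" "U 0 = mat 1"
  shows "ray_asymptotic \<theta>\<^sub>i t m j 1 y"
  unfolding ray_asymptotic_def
proof
  fix i
  show "((\<lambda>x. y (ray m x) $ i * exp (- (sigma3 $ j $ j) * phase \<theta>\<^sub>i t (ray m x)))
             \<longlongrightarrow> (if i = j then 1 else 0)) at_top"
    using has_expansion_imp_tendsto_ray[OF _ assms(2), of _ "\<lambda>n. U n $ i $ j"] assms(1,3)
    by (fastforce simp: asymptotic_to_column_def phase_def mat_def)
qed

text \<open>Four sectors make a full turn. It leaves exp \<zeta> unchanged, so only the term linear
  in \<zeta> of the phase moves, and it contributes a constant factor.\<close>

lemma ray_asymptotic_translate:
  assumes "ray_asymptotic \<theta>\<^sub>i t m j c y"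
  shows "ray_asymptotic \<theta>\<^sub>i t (m + 4) j (exp (sigma3 $ j $ j * (2 * pi * \<i> * \<theta>\<^sub>i)) * c) (\<lambda>\<zeta>. y (\<zeta> - 2 * pi * \<i>))"
  unfolding ray_asymptotic_def
proof
  fix i
  have ray: "ray (m + 4) x - 2 * pi * \<i> = ray m x" for x
    by (simp add: ray_def complex_eq_iff field_simps)
  have phase: "phase \<theta>\<^sub>i t (ray (m + 4) x) = phase \<theta>\<^sub>i t (ray m x) - 2 * pi * \<i> * \<theta>\<^sub>i" for x
  proof -
    have "exp (ray (m + 4) x) = exp (ray m x)"
      unfolding ray[symmetric] by (simp add: exp_diff)
    then show ?thesis
      by (simp add: phase_def ray[symmetric] algebra_simps)
  qed
  have e: "exp (- (sigma3 $ j $ j) * phase \<theta>\<^sub>i t (ray (m + 4) x)) =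
      exp (sigma3 $ j $ j * (2 * pi * \<i> * \<theta>\<^sub>i)) * exp (- (sigma3 $ j $ j) * phase \<theta>\<^sub>i t (ray m x))" for x
    unfolding phase by (simp add: exp_add[symmetric] algebra_simps)
  have "((\<lambda>x. exp (sigma3 $ j $ j * (2 * pi * \<i> * \<theta>\<^sub>i)) * (y (ray m x) $ i * exp (- (sigma3 $ j $ j) * phase \<theta>\<^sub>i t (ray m x))))
      \<longlongrightarrow> exp (sigma3 $ j $ j * (2 * pi * \<i> * \<theta>\<^sub>i)) * (if i = j then c else 0)) at_top"
    using assms unfolding ray_asymptotic_def by (intro tendsto_mult_left) auto
  then show "((\<lambda>x. y (ray (m + 4) x - 2 * pi * \<i>) $ i * exp (- (sigma3 $ j $ j) * phase \<theta>\<^sub>i t (ray (m + 4) x)))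
             \<longlongrightarrow> (if i = j then exp (sigma3 $ j $ j * (2 * pi * \<i> * \<theta>\<^sub>i)) * c else 0)) at_top"
    unfolding ray e by (auto simp: mult_ac split: if_splits)
qed

text \<open>The sign of the recessive column is opposite to that of z^2 on the ray, so the exponent
  has real part -e^(2x) plus terms of order e^x and x.\<close>

lemma tendsto_exp_phase_recessive:
  "((\<lambda>x. exp (2 * sigma3 $ recessive m $ recessive m * phase \<theta>\<^sub>i t (ray m x))) \<longlongrightarrow> 0) at_top"
proof (rule Lim_null_comparison)
  define s :: complex where "s = sigma3 $ recessive m $ recessive m"
  have s: "s = (if even m then 1 else -1)"
    by (simp add: s_def recessive_def sigma3_def)
  define C where "C = \<bar>(of_int m - 1) * pi / 2\<bar>"
  have "norm (exp (2 * s * phase \<theta>\<^sub>i t (ray m x))) \<le>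
      exp (- (exp x ^ 2) + 2 * (norm t * exp x + norm \<theta>\<^sub>i * (\<bar>x\<bar> + C)))" for x
  proof -
    have "exp (ray m x) ^ 2 = exp (ray m x + ray m x)"
      by (simp only: power2_eq_square exp_add)
    also have "ray m x + ray m x = Complex (2 * x) (pi * of_int (m - 1))"
      by (simp add: ray_def complex_eq_iff field_simps)
    also have "exp \<dots> = of_real (exp (2 * x)) * cis (pi * of_int (m - 1))"
      by (simp add: exp_eq_polar del: of_int_diff)
    also have "cis (pi * of_int (m - 1)) = - s"
      by (simp add: complex_eq_iff s del: of_int_diff)
    also have "exp (2 * x) = exp x ^ 2"
      by (rule exp_double)
    finally have "2 * s * phase \<theta>\<^sub>i t (ray m x) =
        of_real (- (exp x ^ 2)) + 2 * s * (t * exp (ray m x) - \<theta>\<^sub>i * ray m x)"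
      by (simp add: phase_def algebra_simps s split: if_splits)
    then have "Re (2 * s * phase \<theta>\<^sub>i t (ray m x)) =
        - (exp x ^ 2) + Re (2 * s * (t * exp (ray m x) - \<theta>\<^sub>i * ray m x))"
      by (simp only: plus_complex.sel Re_complex_of_real)
    also have "\<dots> \<le> - (exp x ^ 2) + norm (2 * s * (t * exp (ray m x) - \<theta>\<^sub>i * ray m x))"
      using complex_Re_le_cmod by (intro add_left_mono)
    also have "norm (2 * s * (t * exp (ray m x) - \<theta>\<^sub>i * ray m x)) =
        2 * norm (t * exp (ray m x) - \<theta>\<^sub>i * ray m x)"
      by (simp add: norm_mult s)
    also have "norm (t * exp (ray m x) - \<theta>\<^sub>i * ray m x) \<le> norm (t * exp (ray m x)) + norm (\<theta>\<^sub>i * ray m x)"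
      by (rule norm_triangle_ineq4)
    also have "norm (t * exp (ray m x)) = norm t * exp x"
      by (simp add: norm_mult ray_def)
    also have "norm (\<theta>\<^sub>i * ray m x) \<le> norm \<theta>\<^sub>i * (\<bar>x\<bar> + C)"
      using cmod_le[of "ray m x"] by (simp add: norm_mult ray_def C_def mult_left_mono)
    finally show ?thesis
      by simp
  qed
  then show "\<forall>\<^sub>F x in at_top. norm (exp (2 * s * phase \<theta>\<^sub>i t (ray m x))) \<le>
      exp (- (exp x ^ 2) + 2 * (norm t * exp x + norm \<theta>\<^sub>i * (\<bar>x\<bar> + C)))"
    by simp
  show "((\<lambda>x. exp (- (exp x ^ 2) + 2 * (norm t * exp x + norm \<theta>\<^sub>i * (\<bar>x\<bar> + C)))) \<longlongrightarrow> 0) at_top"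
    by real_asymp
qed

text \<open>The two normalising exponentials merge into one, which is 1 when the columns differ and
  a squared exponential when they agree.\<close>

lemma wronskian_tendsto_ray:
  assumes "ray_asymptotic \<theta>\<^sub>i t m j c y" "ray_asymptotic \<theta>\<^sub>i t m j' c' y'"
  shows "((\<lambda>x. wronskian (y (ray m x)) (y' (ray m x)) *
            exp (- (sigma3 $ j $ j + sigma3 $ j' $ j') * phase \<theta>\<^sub>i t (ray m x)))
          \<longlongrightarrow> wronskian (axis j c) (axis j' c')) at_top"
proof -
  let ?e = "\<lambda>j x. exp (- (sigma3 $ j $ j) * phase \<theta>\<^sub>i t (ray m x))"
  have lim: "((\<lambda>x. y (ray m x) $ i * ?e j x) \<longlongrightarrow> axis j c $ i) at_top"
    "((\<lambda>x. y' (ray m x) $ i * ?e j' x) \<longlongrightarrow> axis j' c' $ i) at_top" for i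
    using assms by (simp_all add: ray_asymptotic_def axis_def)
  have "wronskian (y (ray m x)) (y' (ray m x)) *
            exp (- (sigma3 $ j $ j + sigma3 $ j' $ j') * phase \<theta>\<^sub>i t (ray m x)) =
      (y (ray m x) $ 1 * ?e j x) * (y' (ray m x) $ 2 * ?e j' x) -
      (y (ray m x) $ 2 * ?e j x) * (y' (ray m x) $ 1 * ?e j' x)" for x
    by (simp add: wronskian_def algebra_simps flip: exp_add)
  then show ?thesis
    unfolding wronskian_def by (simp only:) (intro tendsto_diff tendsto_mult lim)
qed

context
  fixes A\<^sub>0 A\<^sub>m :: "complex^2^2"
  assumes traces: "trace A\<^sub>0 = 0" "trace A\<^sub>m = 0"
begin

text \<open>For opposite signs the exponentials cancel, and a constant equals its limit.\<close>

lemma wronskian_columns: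
  assumes "is_solution A\<^sub>0 A\<^sub>m y" "is_solution A\<^sub>0 A\<^sub>m y'"
    and "ray_asymptotic \<theta>\<^sub>i t m 1 c y" "ray_asymptotic \<theta>\<^sub>i t m 2 c' y'"
  shows "wronskian (y \<zeta>) (y' \<zeta>) = c * c'"
proof -
  have W: "wronskian (y (ray m x)) (y' (ray m x)) = wronskian (y \<zeta>) (y' \<zeta>)" for x
    by (rule wronskian_constant[OF traces assms(1,2)])
  have "wronskian (axis 1 c) (axis 2 c') = c * c'"
    by (simp add: wronskian_def axis_def)
  then have "((\<lambda>x::real. wronskian (y \<zeta>) (y' \<zeta>)) \<longlongrightarrow> c * c') at_top"
    using wronskian_tendsto_ray[OF assms(3,4)]
    by (simp add: W sigma3_def)
  then show ?thesis
    by (simp add: tendsto_const_iff)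
qed

text \<open>The constant is written as a convergent quantity times the square of the decaying
  exponential, hence tends to 0.\<close>

lemma wronskian_recessive:
  assumes "is_solution A\<^sub>0 A\<^sub>m y" "is_solution A\<^sub>0 A\<^sub>m y'"
    and "ray_asymptotic \<theta>\<^sub>i t m (recessive m) c y" "ray_asymptotic \<theta>\<^sub>i t m (recessive m) c' y'"
  shows "wronskian (y \<zeta>) (y' \<zeta>) = 0"
proof -
  have W: "wronskian (y (ray m x)) (y' (ray m x)) = wronskian (y \<zeta>) (y' \<zeta>)" for x
    by (rule wronskian_constant[OF traces assms(1,2)])
  let ?s = "sigma3 $ recessive m $ recessive m :: complex"
  have "((\<lambda>x. (wronskian (y \<zeta>) (y' \<zeta>) * exp (- (?s + ?s) * phase \<theta>\<^sub>i t (ray m x))) *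
      exp (2 * ?s * phase \<theta>\<^sub>i t (ray m x))) \<longlongrightarrow>
      wronskian (axis (recessive m) c) (axis (recessive m) c') * 0) at_top"
    using wronskian_tendsto_ray[OF assms(3,4)]
    by (intro tendsto_mult tendsto_exp_phase_recessive)
      (simp add: W)
  then have "((\<lambda>x::real. wronskian (y \<zeta>) (y' \<zeta>)) \<longlongrightarrow> 0) at_top"
    by (simp add: mult.assoc exp_add[symmetric] algebra_simps)
  then show ?thesis
    by (simp add: tendsto_const_iff)
qed

text \<open>Cramer's rule expands \<open>y\<close> in the columns of \<open>Y\<close>, whose
  determinant is 1. The coefficient of the dominant column is a Wronskian of two recessive
  solutions, so it vanishes; the other is read off from the leading terms.\<close>

lemma recessive_solution_unique:
  assumes "is_solution A\<^sub>0 A\<^sub>m y" "ray_asymptotic \<theta>\<^sub>i t m (recessive m) c y"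
    and "\<And>j. is_solution A\<^sub>0 A\<^sub>m (\<lambda>\<zeta>. column j (Y \<zeta>))"
    and "\<And>j. ray_asymptotic \<theta>\<^sub>i t m j 1 (\<lambda>\<zeta>. column j (Y \<zeta>))"
  shows "y \<zeta> = c *s column (recessive m) (Y \<zeta>)"
proof -
  let ?f = "column 1 (Y \<zeta>)" and ?g = "column 2 (Y \<zeta>)"
  have W: "wronskian ?f ?g = 1"
    using wronskian_columns[OF assms(3,3,4,4)] by simp
  have cramer: "y \<zeta> = wronskian (y \<zeta>) ?g *s ?f + wronskian ?f (y \<zeta>) *s ?g"
  proof -
    have "wronskian ?f ?g *s y \<zeta> = wronskian (y \<zeta>) ?g *s ?f + wronskian ?f (y \<zeta>) *s ?g"
      by (simp add: vec_eq_iff forall_2 wronskian_def algebra_simps)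
    then show ?thesis
      using W by simp
  qed
  show ?thesis
  proof (cases "even m")
    case True
    then have "wronskian (y \<zeta>) ?g = c" "wronskian ?f (y \<zeta>) = 0"
      using wronskian_columns[OF assms(1,3) _ assms(4)] wronskian_recessive[OF assms(3,1) assms(4,2)] assms(2)
      by (simp_all add: recessive_def)
    with True cramer show ?thesis by (simp add: recessive_def)
  next
    case False
    then have "wronskian (y \<zeta>) ?g = 0" "wronskian ?f (y \<zeta>) = c"
      using wronskian_columns[OF assms(3,1,4)] wronskian_recessive[OF assms(1,3) assms(2,4)] assms(2)
      by (simp_all add: recessive_def)
    with False cramer show ?thesis by (simp add: recessive_def)
  qed
qed

end

section \<open>Monodromy at the origin\<close>

text \<open>A short-time form of Gronwall's inequality. At a maximum \<open>m\<close> of the norm,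
  the mean value bound gives norm (F m) \<le> norm (F 0) + norm (F m) / 2, so the maximum is at most
  twice the initial norm; this is inserted into the same bound.\<close>

lemma norm_diff_le_of_small_derivative:
  fixes F :: "real \<Rightarrow> 'a::real_normed_vector"
  assumes F: "\<And>\<tau>. \<tau> \<in> {0..T} \<Longrightarrow> (F has_vector_derivative F' \<tau>) (at \<tau> within {0..T})"
    and F': "\<And>\<tau>. \<tau> \<in> {0..T} \<Longrightarrow> norm (F' \<tau>) \<le> \<epsilon> * norm (F \<tau>)"
    and "0 \<le> T" "0 \<le> \<epsilon>" "\<epsilon> * T \<le> 1 / 2"
  shows "norm (F T - F 0) \<le> 2 * (\<epsilon> * T) * norm (F 0)"
proof -
  have "continuous_on {0..T} F"
    using has_vector_derivative_continuous[OF F] by (simp add: continuous_on_eq_continuous_within)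
  then have "continuous_on {0..T} (\<lambda>\<tau>. norm (F \<tau>))"
    by (rule continuous_on_norm)
  then obtain m where m: "m \<in> {0..T}" "\<And>\<tau>. \<tau> \<in> {0..T} \<Longrightarrow> norm (F \<tau>) \<le> norm (F m)"
    using continuous_attains_sup[of "{0..T}" "\<lambda>\<tau>. norm (F \<tau>)"] \<open>0 \<le> T\<close> by auto
  have bound: "norm (F \<tau> - F 0) \<le> \<epsilon> * T * norm (F m)" if "\<tau> \<in> {0..T}" for \<tau>
  proof -
    have "norm (F \<tau> - F 0) \<le> \<epsilon> * norm (F m) * norm (\<tau> - 0)"
    proof (rule differentiable_bound[of "{0..T}" F "\<lambda>\<tau> h. h *\<^sub>R F' \<tau>"])
      fix \<tau> assume \<tau>: "\<tau> \<in> {0..T}"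
      show "(F has_derivative (\<lambda>h. h *\<^sub>R F' \<tau>)) (at \<tau> within {0..T})"
        using F[OF \<tau>] by (simp add: has_vector_derivative_def)
      have "norm (F' \<tau>) \<le> \<epsilon> * norm (F m)"
        using F'[OF \<tau>] mult_left_mono[OF m(2)[OF \<tau>] \<open>0 \<le> \<epsilon>\<close>] by linarith
      then show "onorm (\<lambda>h. h *\<^sub>R F' \<tau>) \<le> \<epsilon> * norm (F m)"
        using \<open>0 \<le> \<epsilon>\<close> by (intro onorm_bound) (auto simp: mult.commute[of _ "\<bar>_\<bar>"] mult_left_mono)
    qed (use that \<open>0 \<le> T\<close> in auto)
    also have "\<dots> \<le> \<epsilon> * norm (F m) * T"
      using that \<open>0 \<le> \<epsilon>\<close> by (intro mult_left_mono) auto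
    finally show ?thesis by (simp add: mult_ac)
  qed
  have "norm (F m) \<le> norm (F 0) + norm (F m - F 0)"
    by (rule norm_triangle_sub)
  also have "norm (F m - F 0) \<le> \<epsilon> * T * norm (F m)"
    using bound m(1) .
  also have "\<dots> \<le> 1 / 2 * norm (F m)"
    using \<open>\<epsilon> * T \<le> 1 / 2\<close> by (intro mult_right_mono) auto
  finally have "norm (F m) \<le> 2 * norm (F 0)" by simp
  then have "\<epsilon> * T * norm (F m) \<le> \<epsilon> * T * (2 * norm (F 0))"
    using \<open>0 \<le> T\<close> \<open>0 \<le> \<epsilon>\<close> by (intro mult_left_mono) auto
  with bound[of T] \<open>0 \<le> T\<close> show ?thesis by simp
qed

text \<open>
  After removing the factors \<open>e\<^bsup>\<plusminus>\<theta>\<zeta>\<^esup>\<close>, the vector \<open>(p, q)\<close> hardly varies along the segment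
  from \<open>x\<close> to \<open>x - 2\<pi>i\<close> once \<open>x\<close> is very negative.
\<close>

lemma multiplier_of_near_diagonal_system:
  fixes p q r1 r2 :: "complex \<Rightarrow> complex"
  assumes p: "\<And>\<zeta>. (p has_field_derivative \<theta> * p \<zeta> + r1 \<zeta>) (at \<zeta>)"
    and q: "\<And>\<zeta>. (q has_field_derivative - \<theta> * q \<zeta> + r2 \<zeta>) (at \<zeta>)"
    and r1: "\<And>\<zeta>. Re \<zeta> \<le> 0 \<Longrightarrow> norm (r1 \<zeta>) \<le> K * exp (Re \<zeta>) * (norm (p \<zeta>) + norm (q \<zeta>))"
    and r2: "\<And>\<zeta>. Re \<zeta> \<le> 0 \<Longrightarrow> norm (r2 \<zeta>) \<le> K * exp (Re \<zeta>) * (norm (p \<zeta>) + norm (q \<zeta>))"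
    and "0 \<le> K"
    and nz: "\<And>\<zeta>. p \<zeta> \<noteq> 0 \<or> q \<zeta> \<noteq> 0"
    and l: "\<And>\<zeta>. p (\<zeta> - 2 * pi * \<i>) = l * p \<zeta>" "\<And>\<zeta>. q (\<zeta> - 2 * pi * \<i>) = l * q \<zeta>"
  shows "l = exp (2 * pi * \<i> * \<theta>) \<or> l = exp (- (2 * pi * \<i> * \<theta>))"
proof -
  \<comment> \<open>\<open>a\<close> and \<open>b\<close> are the relative changes of the two
    rescaled components over one turn. The claim is that one of them is 0, that is, \<mu> =
    0.\<close>
  define a where "a = exp (2 * pi * \<i> * \<theta>) * l - 1"
  define b where "b = exp (- (2 * pi * \<i> * \<theta>)) * l - 1"
  define \<mu> where "\<mu> = min (norm a) (norm b)"
  define E where "E = exp (2 * pi * norm \<theta>)"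
  \<comment> \<open>One factor \<open>E\<close> pays for undoing the rescaling, the other for the
    exponential in \<open>P'\<close> and \<open>Q'\<close>; each of the two sums over components
    costs a factor 2.\<close>
  define M where "M = 4 * E ^ 2 * K"
  have E: "norm (exp (of_real \<tau> * (\<i> * \<theta>))) \<le> E" "norm (exp (- (of_real \<tau> * (\<i> * \<theta>)))) \<le> E"
    if "\<tau> \<in> {0..2 * pi}" for \<tau>
  proof -
    have "norm (of_real \<tau> * (\<i> * \<theta>)) \<le> 2 * pi * norm \<theta>"
      using that by (simp add: norm_mult mult_right_mono)
    then show "norm (exp (of_real \<tau> * (\<i> * \<theta>))) \<le> E" "norm (exp (- (of_real \<tau> * (\<i> * \<theta>)))) \<le> E"
      unfolding E_def norm_exp_eq_Re exp_le_cancel_iff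
      using complex_Re_le_cmod[of "of_real \<tau> * (\<i> * \<theta>)"] complex_Re_le_cmod[of "- (of_real \<tau> * (\<i> * \<theta>))"]
      by (simp_all only: norm_minus_cancel)
  qed
  have main: "\<mu> \<le> 8 * pi * (M * exp x)" if "x \<le> 0" "M * exp x * (2 * pi) \<le> 1 / 2" for x
  proof -
    define \<epsilon> where "\<epsilon> = M * exp x"
    have "0 \<le> \<epsilon>" using \<open>0 \<le> K\<close> by (simp add: \<epsilon>_def M_def)
    \<comment> \<open>The path runs downwards from \<open>x\<close>, a clockwise turn around 0. On
      it \<open>P\<close> and \<open>Q\<close> would be constant if the remainders vanished.\<close>
    define c where "c = (\<lambda>\<tau>. of_real x - of_real \<tau> * \<i>)"
    define P where "P = (\<lambda>\<tau>. exp (of_real \<tau> * (\<i> * \<theta>)) * p (c \<tau>))"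
    define Q where "Q = (\<lambda>\<tau>. exp (- (of_real \<tau> * (\<i> * \<theta>))) * q (c \<tau>))"
    define P' where "P' = (\<lambda>\<tau>. - \<i> * exp (of_real \<tau> * (\<i> * \<theta>)) * r1 (c \<tau>))"
    define Q' where "Q' = (\<lambda>\<tau>. - \<i> * exp (- (of_real \<tau> * (\<i> * \<theta>))) * r2 (c \<tau>))"
    have c: "(c has_vector_derivative - \<i>) (at \<tau>)" for \<tau>
      unfolding c_def by (auto intro!: derivative_eq_intros)
    have Re_c: "Re (c \<tau>) = x" for \<tau>
      by (simp add: c_def)
    have e: "((\<lambda>\<tau>. exp (of_real \<tau> * d)) has_vector_derivative d * exp (of_real \<tau> * d)) (at \<tau>)" for d :: complex and \<tau>
      by (auto intro!: derivative_eq_intros has_vector_derivative_real_field)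
    have P: "(P has_vector_derivative P' \<tau>) (at \<tau>)" for \<tau>
      using has_vector_derivative_mult[OF e[of "\<i> * \<theta>"] field_vector_diff_chain_at[OF c p]]
      by (simp add: P_def P'_def algebra_simps o_def)
    have Q: "(Q has_vector_derivative Q' \<tau>) (at \<tau>)" for \<tau>
      using has_vector_derivative_mult[OF e[of "- (\<i> * \<theta>)"] field_vector_diff_chain_at[OF c q]]
      by (simp add: Q_def Q'_def algebra_simps o_def)
    have PQ': "norm (P' \<tau>, Q' \<tau>) \<le> \<epsilon> * norm (P \<tau>, Q \<tau>)" if \<tau>: "\<tau> \<in> {0..2 * pi}" for \<tau>
    proof -
      have "p (c \<tau>) = exp (- (of_real \<tau> * (\<i> * \<theta>))) * P \<tau>"
        by (simp add: P_def exp_minus)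
      then have np: "norm (p (c \<tau>)) \<le> E * norm (P \<tau>)"
        unfolding norm_mult[symmetric] using E[OF \<tau>] by (simp only: norm_mult mult_right_mono norm_ge_zero)
      have "q (c \<tau>) = exp (of_real \<tau> * (\<i> * \<theta>)) * Q \<tau>"
        by (simp add: Q_def exp_minus)
      then have nq: "norm (q (c \<tau>)) \<le> E * norm (Q \<tau>)"
        unfolding norm_mult[symmetric] using E[OF \<tau>] by (simp only: norm_mult mult_right_mono norm_ge_zero)
      have "norm (P \<tau>) \<le> norm (P \<tau>, Q \<tau>)" "norm (Q \<tau>) \<le> norm (P \<tau>, Q \<tau>)"
        by (rule norm_fst_le norm_snd_le)+
      then have "E * norm (P \<tau>) + E * norm (Q \<tau>) \<le> E * (2 * norm (P \<tau>, Q \<tau>))"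
        by (simp add: E_def flip: distrib_left)
      with np nq have pq: "norm (p (c \<tau>)) + norm (q (c \<tau>)) \<le> E * (2 * norm (P \<tau>, Q \<tau>))"
        by linarith
      have "K * exp x * (norm (p (c \<tau>)) + norm (q (c \<tau>))) \<le> K * exp x * (E * (2 * norm (P \<tau>, Q \<tau>)))"
        using \<open>0 \<le> K\<close> pq by (intro mult_left_mono) auto
      then have r: "norm (r1 (c \<tau>)) \<le> K * exp x * (E * (2 * norm (P \<tau>, Q \<tau>)))"
        "norm (r2 (c \<tau>)) \<le> K * exp x * (E * (2 * norm (P \<tau>, Q \<tau>)))"
        using r1[of "c \<tau>"] r2[of "c \<tau>"] \<open>x \<le> 0\<close> by (simp_all add: Re_c)
      have "norm (P' \<tau>) \<le> E * (K * exp x * (E * (2 * norm (P \<tau>, Q \<tau>))))"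
        "norm (Q' \<tau>) \<le> E * (K * exp x * (E * (2 * norm (P \<tau>, Q \<tau>))))"
        unfolding P'_def Q'_def norm_mult norm_minus_cancel norm_ii mult_1_left
        by (intro mult_mono E[OF \<tau>] r; simp add: E_def)+
      moreover have "norm (P' \<tau>, Q' \<tau>) \<le> norm (P' \<tau>) + norm (Q' \<tau>)"
        by (rule norm_Pair_le)
      ultimately show ?thesis
        by (simp add: \<epsilon>_def M_def power2_eq_square mult_ac)
    qed
    define F where "F = (\<lambda>\<tau>. (P \<tau>, Q \<tau>))"
    define F' where "F' = (\<lambda>\<tau>. (P' \<tau>, Q' \<tau>))"
    have "norm (F (2 * pi) - F 0) \<le> 2 * (\<epsilon> * (2 * pi)) * norm (F 0)"
    proof (rule norm_diff_le_of_small_derivative[of "2 * pi" F F' \<epsilon>])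
      show "(F has_vector_derivative F' \<tau>) (at \<tau> within {0..2 * pi})" for \<tau>
        unfolding F_def F'_def by (rule has_vector_derivative_at_within[OF has_vector_derivative_Pair[OF P Q]])
      show "norm (F' \<tau>) \<le> \<epsilon> * norm (F \<tau>)" if "\<tau> \<in> {0..2 * pi}" for \<tau>
        using PQ'[OF that] by (simp only: F_def F'_def)
      show "0 \<le> 2 * pi" by simp
      show "0 \<le> \<epsilon>" by fact
      show "\<epsilon> * (2 * pi) \<le> 1 / 2" using that(2) by (simp only: \<epsilon>_def)
    qed
    then have "norm ((P (2 * pi), Q (2 * pi)) - (P 0, Q 0)) \<le> 2 * (\<epsilon> * (2 * pi)) * norm (P 0, Q 0)"
      by (simp only: F_def)
    moreover have "P (2 * pi) - P 0 = a * p x" "Q (2 * pi) - Q 0 = b * q x"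
      using l[of x] by (simp_all add: P_def Q_def c_def a_def b_def algebra_simps)
    moreover have "norm (P 0, Q 0) \<le> norm (p x) + norm (q x)"
      using norm_Pair_le[of "P 0" "Q 0"] by (simp add: P_def Q_def c_def)
    then have "2 * (\<epsilon> * (2 * pi)) * norm (P 0, Q 0) \<le> 2 * (\<epsilon> * (2 * pi)) * (norm (p x) + norm (q x))"
      using \<open>0 \<le> \<epsilon>\<close> by (intro mult_left_mono) auto
    ultimately have "norm (a * p x, b * q x) \<le> 2 * (\<epsilon> * (2 * pi)) * (norm (p x) + norm (q x))"
      by simp
    \<comment> \<open>The norm of a pair dominates each component, so adding both components doubles
      the bound 4 \<pi> \<epsilon>.\<close>
    then have "norm (a * p x) + norm (b * q x) \<le> 2 * (2 * (\<epsilon> * (2 * pi)) * (norm (p x) + norm (q x)))"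
      using norm_fst_le[of "a * p x" "b * q x"] norm_snd_le[of "b * q x" "a * p x"] by linarith
    then have "norm (a * p x) + norm (b * q x) \<le> 8 * pi * \<epsilon> * (norm (p x) + norm (q x))"
      by (simp add: mult_ac)
    moreover have "\<mu> * norm (p x) \<le> norm (a * p x)" "\<mu> * norm (q x) \<le> norm (b * q x)"
      by (auto simp: \<mu>_def norm_mult intro!: mult_right_mono)
    ultimately have "\<mu> * (norm (p x) + norm (q x)) \<le> 8 * pi * \<epsilon> * (norm (p x) + norm (q x))"
      by (simp add: distrib_left)
    moreover have "0 < norm (p x) + norm (q x)"
      using nz[of x] by (auto intro: add_pos_nonneg add_nonneg_pos)
    ultimately show ?thesis
      by (simp add: \<epsilon>_def)
  qed
  have lim: "((\<lambda>x. M * exp x) \<longlongrightarrow> M * 0) at_bot"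
    by (intro tendsto_mult_left exp_at_bot)
  have "\<forall>\<^sub>F x in at_bot. \<mu> \<le> 8 * pi * (M * exp x)"
  proof -
    have "\<forall>\<^sub>F x in at_bot. M * exp x < 1 / (4 * pi)"
      using lim by (rule order_tendstoD) simp
    with eventually_le_at_bot[of 0] show ?thesis
      by eventually_elim (rule main, auto simp: field_simps)
  qed
  moreover have "((\<lambda>x. 8 * pi * (M * exp x)) \<longlongrightarrow> 8 * pi * (M * 0)) at_bot"
    by (intro tendsto_mult_left lim)
  ultimately have "\<mu> \<le> 0"
    using tendsto_lowerbound[of "\<lambda>x. 8 * pi * (M * exp x)" 0 at_bot \<mu>] by simp
  then have "a = 0 \<or> b = 0"
    by (auto simp: \<mu>_def min_def split: if_splits)
  then show ?thesis
  proof
    assume "a = 0"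
    then show ?thesis
      using inverse_unique[of "exp (2 * pi * \<i> * \<theta>)" l] by (simp add: a_def exp_minus)
  next
    assume "b = 0"
    then show ?thesis by (simp add: b_def exp_minus field_simps)
  qed
qed

lemma wronskian_eigenvectors_nonzero:
  assumes "B *v u = a *s u" "B *v v = b *s v" "a \<noteq> b" "u \<noteq> 0" "v \<noteq> 0"
  shows "wronskian u v \<noteq> 0"
proof
  assume "wronskian u v = 0"
  then have W: "u $ 1 * v $ 2 = u $ 2 * v $ 1"
    by (simp add: wronskian_def)
  have e: "B $ 1 $ 1 * u $ 1 + B $ 1 $ 2 * u $ 2 = a * u $ 1"
    "B $ 2 $ 1 * u $ 1 + B $ 2 $ 2 * u $ 2 = a * u $ 2"
    "B $ 1 $ 1 * v $ 1 + B $ 1 $ 2 * v $ 2 = b * v $ 1"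
    "B $ 2 $ 1 * v $ 1 + B $ 2 $ 2 * v $ 2 = b * v $ 2"
    using assms(1,2) by (simp_all add: vec_eq_iff forall_2 matrix_vector_mult_def sum_2)
  \<comment> \<open>Treating all four products at once avoids a choice of a nonzero
    coordinate.\<close>
  have "(a - b) * (u $ 1 * v $ 1) = 0" "(a - b) * (u $ 1 * v $ 2) = 0"
    "(a - b) * (u $ 2 * v $ 1) = 0" "(a - b) * (u $ 2 * v $ 2) = 0"
    using W e by algebra+
  then have "u $ 1 * v $ 1 = 0" "u $ 1 * v $ 2 = 0" "u $ 2 * v $ 1 = 0" "u $ 2 * v $ 2 = 0"
    using \<open>a \<noteq> b\<close> by simp_all
  then show False
    using assms(4,5) by (auto simp: vec_eq_iff forall_2)
qed

text \<open>With \<theta> nonzero the residue is diagonalisable. The Wronskians of \<open>y\<close>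
  with the two eigenvectors are, up to the factor \<open>D\<close>, its coordinates in the
  eigenbasis, and what remains of the system is O(z).\<close>

lemma monodromy_eigenvalue:
  assumes traces: "trace A\<^sub>0 = 0" "trace A\<^sub>m = 0"
    and eig: "eigenvalues A\<^sub>m = {\<theta>, - \<theta>}" "\<theta> \<noteq> 0"
    and y: "is_solution A\<^sub>0 A\<^sub>m y" "\<And>\<zeta>. y \<zeta> \<noteq> 0"
    and l: "\<And>\<zeta>. y (\<zeta> - 2 * pi * \<i>) = l *s y \<zeta>"
  shows "l = exp (2 * pi * \<i> * \<theta>) \<or> l = exp (- (2 * pi * \<i> * \<theta>))"
proof -
  obtain u v where u: "u \<noteq> 0" "A\<^sub>m *v u = \<theta> *s u" and v: "v \<noteq> 0" "A\<^sub>m *v v = - \<theta> *s v"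
    using eig(1) unfolding eigenvalues_def by blast
  define D where "D = wronskian u v"
  have "\<theta> \<noteq> - \<theta>"
    using eig(2) by (simp add: eq_neg_iff_add_eq_0 flip: mult_2)
  then have "D \<noteq> 0"
    unfolding D_def using wronskian_eigenvectors_nonzero[OF u(2) v(2)] u(1) v(1) by blast
  have e: "A\<^sub>m $ 1 $ 1 * u $ 1 + A\<^sub>m $ 1 $ 2 * u $ 2 = \<theta> * u $ 1"
    "A\<^sub>m $ 2 $ 1 * u $ 1 + A\<^sub>m $ 2 $ 2 * u $ 2 = \<theta> * u $ 2"
    "A\<^sub>m $ 1 $ 1 * v $ 1 + A\<^sub>m $ 1 $ 2 * v $ 2 = - \<theta> * v $ 1"
    "A\<^sub>m $ 2 $ 1 * v $ 1 + A\<^sub>m $ 2 $ 2 * v $ 2 = - \<theta> * v $ 2"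
    using u(2) v(2) by (simp_all add: vec_eq_iff forall_2 matrix_vector_mult_def sum_2)
  have tr: "A\<^sub>0 $ 2 $ 2 = - A\<^sub>0 $ 1 $ 1" "A\<^sub>m $ 2 $ 2 = - A\<^sub>m $ 1 $ 1"
    using traces by (simp_all add: trace_def sum_2 eq_neg_iff_add_eq_0 add.commute)
  define R1 where "R1 \<zeta> = exp \<zeta> * (exp \<zeta> * y \<zeta> $ 1 + A\<^sub>0 $ 1 $ 1 * y \<zeta> $ 1 + A\<^sub>0 $ 1 $ 2 * y \<zeta> $ 2)" for \<zeta>
  define R2 where "R2 \<zeta> = exp \<zeta> * (A\<^sub>0 $ 2 $ 1 * y \<zeta> $ 1 + A\<^sub>0 $ 2 $ 2 * y \<zeta> $ 2 - exp \<zeta> * y \<zeta> $ 2)" for \<zeta>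
  define p where "p \<zeta> = wronskian (y \<zeta>) v" for \<zeta>
  define q where "q \<zeta> = wronskian u (y \<zeta>)" for \<zeta>
  define r1 where "r1 \<zeta> = R1 \<zeta> * v $ 2 - R2 \<zeta> * v $ 1" for \<zeta>
  define r2 where "r2 \<zeta> = u $ 1 * R2 \<zeta> - u $ 2 * R1 \<zeta>" for \<zeta>
  have dy: "((\<lambda>\<zeta>. y \<zeta> $ 1) has_field_derivative
        A\<^sub>m $ 1 $ 1 * y \<zeta> $ 1 + A\<^sub>m $ 1 $ 2 * y \<zeta> $ 2 + R1 \<zeta>) (at \<zeta>)"
    "((\<lambda>\<zeta>. y \<zeta> $ 2) has_field_derivative
        A\<^sub>m $ 2 $ 1 * y \<zeta> $ 1 + A\<^sub>m $ 2 $ 2 * y \<zeta> $ 2 + R2 \<zeta>) (at \<zeta>)" for \<zeta>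
    using y(1) unfolding is_solution_iff R1_def R2_def
    by (simp_all add: algebra_simps power2_eq_square)
  have p': "(p has_field_derivative \<theta> * p \<zeta> + r1 \<zeta>) (at \<zeta>)" for \<zeta>
  proof -
    \<comment> \<open>For the traceless residue B one has W(B y, v) = - W(y, B v), so the eigenvalue
      -\<theta> of \<open>v\<close> turns into +\<theta> for \<open>p\<close>.\<close>
    have "(p has_field_derivative
        (A\<^sub>m $ 1 $ 1 * y \<zeta> $ 1 + A\<^sub>m $ 1 $ 2 * y \<zeta> $ 2 + R1 \<zeta>) * v $ 2 -
        (A\<^sub>m $ 2 $ 1 * y \<zeta> $ 1 + A\<^sub>m $ 2 $ 2 * y \<zeta> $ 2 + R2 \<zeta>) * v $ 1) (at \<zeta>)"
      unfolding p_def wronskian_def by (auto intro!: derivative_eq_intros dy)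
    also have "(A\<^sub>m $ 1 $ 1 * y \<zeta> $ 1 + A\<^sub>m $ 1 $ 2 * y \<zeta> $ 2 + R1 \<zeta>) * v $ 2 -
        (A\<^sub>m $ 2 $ 1 * y \<zeta> $ 1 + A\<^sub>m $ 2 $ 2 * y \<zeta> $ 2 + R2 \<zeta>) * v $ 1 =
        \<theta> * p \<zeta> + r1 \<zeta>"
      using e tr unfolding p_def r1_def wronskian_def by algebra
    finally show ?thesis .
  qed
  have q': "(q has_field_derivative - \<theta> * q \<zeta> + r2 \<zeta>) (at \<zeta>)" for \<zeta>
  proof -
    have "(q has_field_derivative
        u $ 1 * (A\<^sub>m $ 2 $ 1 * y \<zeta> $ 1 + A\<^sub>m $ 2 $ 2 * y \<zeta> $ 2 + R2 \<zeta>) -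
        u $ 2 * (A\<^sub>m $ 1 $ 1 * y \<zeta> $ 1 + A\<^sub>m $ 1 $ 2 * y \<zeta> $ 2 + R1 \<zeta>)) (at \<zeta>)"
      unfolding q_def wronskian_def by (auto intro!: derivative_eq_intros dy)
    also have "u $ 1 * (A\<^sub>m $ 2 $ 1 * y \<zeta> $ 1 + A\<^sub>m $ 2 $ 2 * y \<zeta> $ 2 + R2 \<zeta>) -
        u $ 2 * (A\<^sub>m $ 1 $ 1 * y \<zeta> $ 1 + A\<^sub>m $ 1 $ 2 * y \<zeta> $ 2 + R1 \<zeta>) =
        - \<theta> * q \<zeta> + r2 \<zeta>"
      using e tr unfolding q_def r2_def wronskian_def by algebra
    finally show ?thesis .
  qed
  define a where "a = 1 + norm (A\<^sub>0 $ 1 $ 1) + norm (A\<^sub>0 $ 1 $ 2) + norm (A\<^sub>0 $ 2 $ 1) + norm (A\<^sub>0 $ 2 $ 2)"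
  define b where "b = norm (u $ 1) + norm (u $ 2) + norm (v $ 1) + norm (v $ 2)"
  \<comment> \<open>The inner \<open>b / norm D\<close> bounds \<open>y\<close> by its coordinates,
    \<open>a\<close> bounds the remainder by \<open>y\<close> when the norm of z is at most 1, and
    the outer \<open>b\<close> bounds the pairing with an eigenvector.\<close>
  define K where "K = b * (a * (b / norm D))"
  have "0 \<le> a" "0 \<le> b" by (simp_all add: a_def b_def)
  have y12: "norm (y \<zeta> $ 1) + norm (y \<zeta> $ 2) \<le> b / norm D * (norm (p \<zeta>) + norm (q \<zeta>))" for \<zeta>
  proof -
    have "D * y \<zeta> $ i = p \<zeta> * u $ i + q \<zeta> * v $ i" for i
      using exhaust_2[of i] by (auto simp: D_def p_def q_def wronskian_def algebra_simps)
    then have *: "norm D * norm (y \<zeta> $ i) \<le> norm (p \<zeta>) * norm (u $ i) + norm (q \<zeta>) * norm (v $ i)" for i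
      by (metis norm_mult norm_triangle_ineq)
    have "norm D * (norm (y \<zeta> $ 1) + norm (y \<zeta> $ 2)) \<le>
        norm (p \<zeta>) * (norm (u $ 1) + norm (u $ 2)) + norm (q \<zeta>) * (norm (v $ 1) + norm (v $ 2))"
      using *[of 1] *[of 2] by (simp add: distrib_left)
    also have "\<dots> \<le> norm (p \<zeta>) * b + norm (q \<zeta>) * b"
      by (intro add_mono mult_left_mono) (auto simp: b_def)
    finally show ?thesis
      using \<open>D \<noteq> 0\<close> by (simp add: field_simps)
  qed
  have R: "norm (R1 \<zeta>) \<le> exp (Re \<zeta>) * (a * (b / norm D * (norm (p \<zeta>) + norm (q \<zeta>))))"
      "norm (R2 \<zeta>) \<le> exp (Re \<zeta>) * (a * (b / norm D * (norm (p \<zeta>) + norm (q \<zeta>))))"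
    if "Re \<zeta> \<le> 0" for \<zeta>
  proof -
    have 1: "norm (exp \<zeta>) \<le> 1" using that by simp
    let ?y1 = "norm (y \<zeta> $ 1)" and ?y2 = "norm (y \<zeta> $ 2)"
    have "norm (exp \<zeta> * y \<zeta> $ 1 + A\<^sub>0 $ 1 $ 1 * y \<zeta> $ 1 + A\<^sub>0 $ 1 $ 2 * y \<zeta> $ 2) \<le>
        1 * ?y1 + norm (A\<^sub>0 $ 1 $ 1) * ?y1 + norm (A\<^sub>0 $ 1 $ 2) * ?y2"
      using mult_right_mono[OF 1, of ?y1]
      by (intro norm_triangle_le add_mono) (auto simp: norm_mult)
    also have "\<dots> \<le> a * (?y1 + ?y2)"
      by (simp add: a_def algebra_simps)
    also have "\<dots> \<le> a * (b / norm D * (norm (p \<zeta>) + norm (q \<zeta>)))"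
      using y12 \<open>0 \<le> a\<close> by (intro mult_left_mono)
    finally show "norm (R1 \<zeta>) \<le> exp (Re \<zeta>) * (a * (b / norm D * (norm (p \<zeta>) + norm (q \<zeta>))))"
      unfolding R1_def norm_mult[of "exp \<zeta>"] norm_exp_eq_Re by (intro mult_left_mono) auto
    have "norm (A\<^sub>0 $ 2 $ 1 * y \<zeta> $ 1 + A\<^sub>0 $ 2 $ 2 * y \<zeta> $ 2 - exp \<zeta> * y \<zeta> $ 2) \<le>
        norm (A\<^sub>0 $ 2 $ 1) * ?y1 + norm (A\<^sub>0 $ 2 $ 2) * ?y2 + 1 * ?y2"
      using mult_right_mono[OF 1, of ?y2]
      by (intro norm_triangle_le_diff norm_triangle_le add_mono) (auto simp: norm_mult)
    also have "\<dots> \<le> a * (?y1 + ?y2)"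
      by (simp add: a_def algebra_simps)
    also have "\<dots> \<le> a * (b / norm D * (norm (p \<zeta>) + norm (q \<zeta>)))"
      using y12 \<open>0 \<le> a\<close> by (intro mult_left_mono)
    finally show "norm (R2 \<zeta>) \<le> exp (Re \<zeta>) * (a * (b / norm D * (norm (p \<zeta>) + norm (q \<zeta>))))"
      unfolding R2_def norm_mult[of "exp \<zeta>"] norm_exp_eq_Re by (intro mult_left_mono) auto
  qed
  have r: "norm (c * R1 \<zeta> - d * R2 \<zeta>) \<le> K * exp (Re \<zeta>) * (norm (p \<zeta>) + norm (q \<zeta>))"
    if "Re \<zeta> \<le> 0" "norm c + norm d \<le> b" for c d \<zeta>
  proof -
    let ?M = "exp (Re \<zeta>) * (a * (b / norm D * (norm (p \<zeta>) + norm (q \<zeta>))))"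
    have "norm (c * R1 \<zeta> - d * R2 \<zeta>) \<le> norm c * norm (R1 \<zeta>) + norm d * norm (R2 \<zeta>)"
      by (metis norm_mult norm_triangle_ineq4)
    also have "\<dots> \<le> norm c * ?M + norm d * ?M"
      using R[OF that(1)] by (intro add_mono mult_left_mono) auto
    also have "\<dots> = (norm c + norm d) * ?M"
      by (rule distrib_right[symmetric])
    also have "\<dots> \<le> b * ?M"
      using that(2) \<open>0 \<le> a\<close> \<open>0 \<le> b\<close> by (intro mult_right_mono) auto
    finally show ?thesis
      by (simp add: K_def mult_ac)
  qed
  show ?thesis
  proof (rule multiplier_of_near_diagonal_system[of p \<theta> r1 q r2 K l, OF p' q'])
    fix \<zeta>
    show "norm (r1 \<zeta>) \<le> K * exp (Re \<zeta>) * (norm (p \<zeta>) + norm (q \<zeta>))" if "Re \<zeta> \<le> 0"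
      using r[OF that, of "v $ 2" "v $ 1"] by (simp add: r1_def b_def mult.commute)
    show "norm (r2 \<zeta>) \<le> K * exp (Re \<zeta>) * (norm (p \<zeta>) + norm (q \<zeta>))" if "Re \<zeta> \<le> 0"
      using r[OF that, of "u $ 2" "u $ 1"] by (simp add: r2_def b_def norm_minus_commute)
    show "0 \<le> K" using \<open>0 \<le> a\<close> \<open>0 \<le> b\<close> by (simp add: K_def)
    show "p \<zeta> \<noteq> 0 \<or> q \<zeta> \<noteq> 0"
    proof (rule ccontr)
      assume "\<not> ?thesis"
      then have "norm (y \<zeta> $ 1) + norm (y \<zeta> $ 2) \<le> 0"
        using y12[of \<zeta>] by simp
      then have "y \<zeta> $ 1 = 0" "y \<zeta> $ 2 = 0"
        by (simp_all add: add_nonneg_eq_0_iff order_antisym_conv)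
      then show False
        using y(2)[of \<zeta>] by (simp add: vec_eq_iff forall_2)
    qed
    show "p (\<zeta> - 2 * pi * \<i>) = l * p \<zeta>" "q (\<zeta> - 2 * pi * \<i>) = l * q \<zeta>"
      unfolding p_def q_def wronskian_def l by (simp_all add: algebra_simps)
  qed
qed

section \<open>Lines and curves on the monodromy surface\<close>

text \<open>After clearing denominators every equation of a line depends on \<open>v\<close> only
  through \<open>d = v ^ 3\<close>. The first five treat b_k = v r, where \<open>r\<close> is v_0 or
  1/v_0; the last five treat b_k = 1/v^2.\<close>

lemma surface_equations:
  fixes v r h d a b s t :: complex
  assumes "v \<noteq> 0" "r \<noteq> 0" "d = v ^ 3" "h = r + inverse r"
  shows "(1 + v ^ 6 * s * t) / v\<^sup>2 = v * r \<longleftrightarrow> 1 + d\<^sup>2 * (s * t) = d * r"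
    and "(1 + a) / v\<^sup>2 = v * r \<longleftrightarrow> 1 + a = d * r"
    and "v\<^sup>2 * (1 + a) = inverse (v * r) \<longleftrightarrow> d * r * (1 + a) = 1"
    and "v\<^sup>2 * (1 + a) + v * r * ((1 + b) / v\<^sup>2) = h / v + v\<^sup>2 - inverse (v * r) \<longleftrightarrow> d * a + r * b = 0"
    and "(1 + v ^ 6 * s * t) / v\<^sup>2 + inverse (v * r) * (v\<^sup>2 * (1 + a)) = v * h + 1 / v\<^sup>2 - v * r \<longleftrightarrow>
      d * r * (s * t) + a = 0"
    and "(1 + v ^ 6 * s * t) / v\<^sup>2 = 1 / v\<^sup>2 \<longleftrightarrow> s * t = 0"
    and "(1 + a) / v\<^sup>2 = 1 / v\<^sup>2 \<longleftrightarrow> a = 0"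
    and "v\<^sup>2 * (1 + a) = v\<^sup>2 \<longleftrightarrow> a = 0"
    and "v\<^sup>2 * (1 + a) + 1 / v\<^sup>2 * ((1 + b) / v\<^sup>2) = h / v + v\<^sup>2 - v\<^sup>2 \<longleftrightarrow> d\<^sup>2 * (1 + a) + (1 + b) = d * h"
    and "(1 + v ^ 6 * s * t) / v\<^sup>2 + v\<^sup>2 * (v\<^sup>2 * (1 + a)) = v * h + 1 / v\<^sup>2 - 1 / v\<^sup>2 \<longleftrightarrow>
      1 + d\<^sup>2 * (s * t) + d\<^sup>2 * (1 + a) = d * h"
  subgoal using assms(1-3) by (simp add: field_simps eval_nat_numeral)
  subgoal using assms(1-3) by (simp add: field_simps eval_nat_numeral)
  subgoal using assms(1-3) by (simp add: field_simps eval_nat_numeral)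
  subgoal
  proof -
    have "v\<^sup>2 * (1 + a) + v * r * ((1 + b) / v\<^sup>2) - (h / v + v\<^sup>2 - inverse (v * r)) = (d * a + r * b) / v"
      unfolding assms(3,4) using assms(1,2) by (simp add: field_simps eval_nat_numeral)
    then show ?thesis using \<open>v \<noteq> 0\<close> by (metis divide_eq_0_iff eq_iff_diff_eq_0)
  qed
  subgoal
  proof -
    have "(1 + v ^ 6 * s * t) / v\<^sup>2 + inverse (v * r) * (v\<^sup>2 * (1 + a)) - (v * h + 1 / v\<^sup>2 - v * r) =
        v * (d * r * (s * t) + a) / r"
      unfolding assms(3,4) using assms(1,2) by (simp add: field_simps eval_nat_numeral)
    then show ?thesis using assms(1,2) by (metis divide_eq_0_iff mult_eq_0_iff eq_iff_diff_eq_0)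
  qed
  subgoal using assms(1) by simp
  subgoal using assms(1) by simp
  subgoal using assms(1) by simp
  subgoal
  proof -
    have "v\<^sup>2 * (1 + a) + 1 / v\<^sup>2 * ((1 + b) / v\<^sup>2) - (h / v + v\<^sup>2 - v\<^sup>2) =
        (d\<^sup>2 * (1 + a) + (1 + b) - d * h) / v ^ 4"
      using assms(1,3) by (simp add: field_simps eval_nat_numeral)
    then show ?thesis using \<open>v \<noteq> 0\<close> by (metis divide_eq_0_iff power_not_zero eq_iff_diff_eq_0)
  qed
  subgoal
  proof -
    have "(1 + v ^ 6 * s * t) / v\<^sup>2 + v\<^sup>2 * (v\<^sup>2 * (1 + a)) - (v * h + 1 / v\<^sup>2 - 1 / v\<^sup>2) =
        (1 + d\<^sup>2 * (s * t) + d\<^sup>2 * (1 + a) - d * h) / v\<^sup>2"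
      using assms(1,3) by (simp add: field_simps eval_nat_numeral)
    then show ?thesis using \<open>v \<noteq> 0\<close> by (metis divide_eq_0_iff power_not_zero eq_iff_diff_eq_0)
  qed
  done

text \<open>The equation of the Stokes variety multiplied by \<open>d\<^sup>2\<close>, where \<open>d = e\<^bsup>2\<pi>i\<theta>\<^esup>\<close> and \<open>h = v\<^sub>0 + 1/v\<^sub>0\<close>.\<close>

definition stokes_relation ::
    "complex \<Rightarrow> complex \<Rightarrow> complex \<Rightarrow> complex \<Rightarrow> complex \<Rightarrow> complex \<Rightarrow> bool" where
  "stokes_relation d h s1 s2 s3 s4 \<longleftrightarrow>
     d\<^sup>2 * (s1 * s2 * s3 * s4 + s1 * s2 + s1 * s4 + s3 * s4 + 1) + s2 * s3 + 1 = d * h"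

lemma stokes_relation_swap:
  "stokes_relation d h s1 s2 s3 s4 \<longleftrightarrow> stokes_relation d h s4 s3 s2 s1"
  by (simp add: stokes_relation_def algebra_simps)

text \<open>Multiplied by \<open>r\<close>, the difference of the two sides of the last assumption
  is (d - r)(d r - 1). This is the degenerate case to be excluded for the lines with b_k =
  1/v^2.\<close>

lemma stokes_relation_factor:
  fixes d r h :: complex
  assumes "r \<noteq> 0" "h = r + inverse r" "1 + d\<^sup>2 = d * h"
  shows "d = r \<or> d * r = 1"
proof -
  have "r * h = r\<^sup>2 + 1"
    using assms(1,2) by (simp add: field_simps power2_eq_square)
  then have "(d - r) * (d * r - 1) = 0"
    using assms(3) by algebra
  then show ?thesis by simp
qed

text \<open>
  If \<open>d r = 1\<close> or \<open>d = r\<close>, then some of the twelve lines coincide and the preimage of such a line is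
  larger than claimed; this happens only on singular surfaces.
\<close>

context
  fixes d r h :: complex
  assumes d: "d \<noteq> 0" and r: "r \<noteq> 0" and h: "h = r + inverse r" and dr: "d * r \<noteq> 1" "d \<noteq> r"
begin

text \<open>The equations for x_1 and x_2 combine to d s1 (r s2 + d s4) = 0, and s1 = 0 would force
  d r = 1. Conversely the two resulting equations imply the Stokes relation, so their solution set
  lies on the variety.\<close>

lemma line_x1_x2:
  "stokes_relation d h s1 s2 s3 s4 \<and> 1 + d\<^sup>2 * (s1 * s4) = d * r \<and> d * r * (1 + s1 * s2) = 1 \<and>
      d * (s3 * s4) + r * (s2 * s3) = 0 \<longleftrightarrow>
    s2 + d / r * s4 = 0 \<and> 1 + s1 * s2 = 1 / (d * r)"
    (is "?L \<longleftrightarrow> ?R")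
proof -
  have R: "?R \<longleftrightarrow> r * s2 + d * s4 = 0 \<and> d * r * (1 + s1 * s2) = 1"
    using d r by (simp add: field_simps)
  have "r * s2 + d * s4 = 0" if ?L
  proof -
    have "s1 \<noteq> 0"
      using that dr by auto
    moreover have "d * s1 * (r * s2 + d * s4) = 0"
      using conjunct1[OF conjunct2[OF that]] conjunct1[OF conjunct2[OF conjunct2[OF that]]] by algebra
    ultimately show ?thesis using d by simp
  qed
  moreover have ?L if "r * s2 + d * s4 = 0" "d * r * (1 + s1 * s2) = 1"
  proof -
    have rh: "r * h = r\<^sup>2 + 1" using r h by (simp add: field_simps power2_eq_square)
    have 1: "1 + d\<^sup>2 * (s1 * s4) = d * r" "d * (s3 * s4) + r * (s2 * s3) = 0"
      using that by algebra+
    have "r * (d\<^sup>2 * (s1 * s2 * s3 * s4 + s1 * s2 + s1 * s4 + s3 * s4 + 1) + s2 * s3 + 1) = r * (d * h)"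
      using that rh 1 by algebra
    with r have "stokes_relation d h s1 s2 s3 s4"
      by (simp add: stokes_relation_def)
    with 1 that show ?thesis by simp
  qed
  ultimately show ?thesis unfolding R by blast
qed

text \<open>Here the equations for x_4 and x_2 combine to s2 (d r s1 + s3) = 0, and again s2 = 0
  would force d r = 1.\<close>

lemma line_x4_x2:
  "stokes_relation d h s1 s2 s3 s4 \<and> 1 + s2 * s3 = d * r \<and> d * r * (1 + s1 * s2) = 1 \<and>
      d * r * (s1 * s4) + s3 * s4 = 0 \<longleftrightarrow>
    s1 + 1 / (d * r) * s3 = 0 \<and> 1 + s2 * s3 = d * r"
    (is "?L \<longleftrightarrow> ?R")
proof -
  have R: "?R \<longleftrightarrow> d * r * s1 + s3 = 0 \<and> 1 + s2 * s3 = d * r"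
    using d r by (simp add: field_simps)
  have "d * r * s1 + s3 = 0" if ?L
  proof -
    have "s2 \<noteq> 0"
      using that dr by auto
    moreover have "s2 * (d * r * s1 + s3) = 0"
      using conjunct1[OF conjunct2[OF that]] conjunct1[OF conjunct2[OF conjunct2[OF that]]] by algebra
    ultimately show ?thesis by simp
  qed
  moreover have ?L if "d * r * s1 + s3 = 0" "1 + s2 * s3 = d * r"
  proof -
    have rh: "r * h = r\<^sup>2 + 1" using r h by (simp add: field_simps power2_eq_square)
    have 1: "d * r * (1 + s1 * s2) = 1" "d * r * (s1 * s4) + s3 * s4 = 0"
      using that by algebra+
    have "r * (d\<^sup>2 * (s1 * s2 * s3 * s4 + s1 * s2 + s1 * s4 + s3 * s4 + 1) + s2 * s3 + 1) = r * (d * h)"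
      using that rh 1 by algebra
    with r have "stokes_relation d h s1 s2 s3 s4"
      by (simp add: stokes_relation_def)
    with 1 that show ?thesis by simp
  qed
  ultimately show ?thesis unfolding R by blast
qed

text \<open>This is the reversal of \<open>line_x4_x2\<close>, with the second equation rewritten by
  means of s2 = - d r s4.\<close>

lemma line_x4_x3:
  "stokes_relation d h s1 s2 s3 s4 \<and> 1 + s2 * s3 = d * r \<and> d * r * (1 + s3 * s4) = 1 \<and>
      d * r * (s1 * s4) + s1 * s2 = 0 \<longleftrightarrow>
    s2 + d * r * s4 = 0 \<and> 1 + s3 * s4 = 1 / (d * r)"
proof -
  have "s2 + d * r * s4 = 0 \<and> 1 + s3 * s4 = 1 / (d * r) \<longleftrightarrow>
      s4 + 1 / (d * r) * s2 = 0 \<and> 1 + s3 * s2 = d * r"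
  proof -
    have "s2 + d * r * s4 = 0 \<longleftrightarrow> s4 + 1 / (d * r) * s2 = 0"
      using d r by (simp add: field_simps)
    moreover have "1 + s3 * s4 = 1 / (d * r) \<longleftrightarrow> 1 + s3 * s2 = d * r" if "s2 + d * r * s4 = 0"
    proof -
      have "s2 = - (d * r * s4)" using that by (simp add: eq_neg_iff_add_eq_0)
      then show ?thesis
        using d r by (auto simp: field_simps)
    qed
    ultimately show ?thesis by blast
  qed
  then show ?thesis
    using line_x4_x2[of s4 s3 s2 s1] stokes_relation_swap[of d h s1 s2 s3 s4] by (auto simp: mult_ac)
qed

text \<open>If s1 is nonzero, then s2 = s4 = 0 and the last equation degenerates to 1 + d^2 = d h,
  which is excluded. If s1 = 0, the last equation is the Stokes relation.\<close>

lemma line_s1: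
  "stokes_relation d h s1 s2 s3 s4 \<and> s1 * s4 = 0 \<and> s1 * s2 = 0 \<and>
      d\<^sup>2 * (1 + s3 * s4) + (1 + s2 * s3) = d * h \<longleftrightarrow>
    stokes_relation d h s1 s2 s3 s4 \<and> s1 = 0"
  using stokes_relation_factor[OF r h, of d] dr d
  by (cases "s1 = 0") (auto simp: stokes_relation_def algebra_simps)

lemma line_s2:
  "stokes_relation d h s1 s2 s3 s4 \<and> s2 * s3 = 0 \<and> s1 * s2 = 0 \<and>
      1 + d\<^sup>2 * (s1 * s4) + d\<^sup>2 * (1 + s3 * s4) = d * h \<longleftrightarrow>
    stokes_relation d h s1 s2 s3 s4 \<and> s2 = 0"
  using stokes_relation_factor[OF r h, of d] dr d
  by (cases "s2 = 0") (auto simp: stokes_relation_def algebra_simps)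

end

section \<open>Singular surfaces and coincidences among u_1, u_2, u_3\<close>

lemma vector_4 [simp]:
  "(vector [x, y, z, w] :: 'a::zero^4) $ 1 = x"
  "(vector [x, y, z, w] :: 'a::zero^4) $ 2 = y"
  "(vector [x, y, z, w] :: 'a::zero^4) $ 3 = z"
  "(vector [x, y, z, w] :: 'a::zero^4) $ 4 = w"
  by (simp_all add: vector_def)

text \<open>
  With \<open>u\<^sub>3 = 1/(u\<^sub>1 u\<^sub>2)\<close>, \<open>w\<^sub>1\<close> and \<open>w\<^sub>2\<close> are the first two elementary symmetric functions of
  \<open>u\<^sub>1, u\<^sub>2, u\<^sub>3\<close>; if two of the three equal \<open>x\<close>, then \<open>(x, 1/x, 1/x, x)\<close> is a singular point.
\<close>

lemma W_sing_memberI: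
  assumes "x \<noteq> 0" "fst w = 2 * x + 1 / x\<^sup>2" "snd w = 2 / x + x\<^sup>2"
  shows "w \<in> W_sing"
proof -
  let ?p = "(x, 1 / x, 1 / x, x)" and ?u = "vector [1, 1 / x, 1 / x, 1] :: complex^4"
  have "?p \<in> monodromy_surface w"
    using assms by (simp add: monodromy_surface_def power2_eq_square)
  moreover have "rank (surface_jacobian ?p) < 2"
  proof -
    have "row i (surface_jacobian ?p) = (if i = 1 then 1 else x) *s ?u" for i
      using exhaust_2[of i] assms(1)
      by (auto simp: surface_jacobian_def row_def vec_eq_iff forall_4)
    then have "rows (surface_jacobian ?p) \<subseteq> vec.span {?u}"
      unfolding rows_def by (auto intro: vec.span_scale vec.span_base)
    then have "rank (surface_jacobian ?p) \<le> card {?u}"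
      unfolding row_rank_def_gen by (intro vec.dim_le_card) auto
    then show ?thesis by simp
  qed
  ultimately show ?thesis
    by (auto simp: W_sing_def)
qed

lemma v_inf_cubed: "v_inf \<theta>\<^sub>i ^ 3 = exp (2 * pi * \<i> * \<theta>\<^sub>i)"
  by (simp add: v_inf_def mult_ac flip: exp_of_nat_mult)

text \<open>In order, these exclude u_1 = u_2, u_2 = u_3 and u_1 = u_3. The repeated value producing
  a singular point is v v_0 in the first case and u_3 = 1/v^2 in the other two.\<close>

lemma w_param_nonsingular:
  assumes "w_param \<theta>\<^sub>0 \<theta>\<^sub>i \<notin> W_sing"
  shows "v_zero \<theta>\<^sub>0 \<noteq> inverse (v_zero \<theta>\<^sub>0)"
    and "exp (2 * pi * \<i> * \<theta>\<^sub>i) \<noteq> v_zero \<theta>\<^sub>0"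
    and "exp (2 * pi * \<i> * \<theta>\<^sub>i) * v_zero \<theta>\<^sub>0 \<noteq> 1"
proof -
  define v u where "v = v_inf \<theta>\<^sub>i" and "u = v_zero \<theta>\<^sub>0"
  have nz: "v \<noteq> 0" "u \<noteq> 0" by (simp_all add: v_def u_def v_inf_def v_zero_def)
  have w: "fst (w_param \<theta>\<^sub>0 \<theta>\<^sub>i) = v * (u + inverse u) + 1 / v\<^sup>2"
    "snd (w_param \<theta>\<^sub>0 \<theta>\<^sub>i) = (u + inverse u) / v + v\<^sup>2"
    by (simp_all add: w_param_def Let_def v_def u_def)
  have sing: False if "fst (w_param \<theta>\<^sub>0 \<theta>\<^sub>i) = 2 * x + 1 / x\<^sup>2" "snd (w_param \<theta>\<^sub>0 \<theta>\<^sub>i) = 2 / x + x\<^sup>2" "x \<noteq> 0" for x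
    using W_sing_memberI[of x "w_param \<theta>\<^sub>0 \<theta>\<^sub>i"] that assms by simp
  show "v_zero \<theta>\<^sub>0 \<noteq> inverse (v_zero \<theta>\<^sub>0)"
  proof
    assume "v_zero \<theta>\<^sub>0 = inverse (v_zero \<theta>\<^sub>0)"
    then have u: "inverse u = u"
      by (simp add: u_def)
    have u2: "u\<^sup>2 = 1"
      using nz u by (simp add: power2_eq_square field_simps)
    show False
    proof (rule sing[of "v * u"])
      have "2 / (v * u) = 2 * inverse u / v"
        by (simp add: divide_inverse)
      then show "snd (w_param \<theta>\<^sub>0 \<theta>\<^sub>i) = 2 / (v * u) + (v * u)\<^sup>2"
        unfolding w by (simp add: u power_mult_distrib u2)
    qed (use nz in \<open>simp_all add: w u power_mult_distrib u2\<close>)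
  qed
  have d: "exp (2 * pi * \<i> * \<theta>\<^sub>i) = v ^ 3"
    by (simp add: v_def v_inf_cubed)
  show "exp (2 * pi * \<i> * \<theta>\<^sub>i) \<noteq> v_zero \<theta>\<^sub>0"
  proof
    assume "exp (2 * pi * \<i> * \<theta>\<^sub>i) = v_zero \<theta>\<^sub>0"
    then have "u = v ^ 3" using d by (simp add: u_def)
    with nz show False
      by (intro sing[of "1 / v\<^sup>2"]) (simp_all add: w eval_nat_numeral field_simps)
  qed
  show "exp (2 * pi * \<i> * \<theta>\<^sub>i) * v_zero \<theta>\<^sub>0 \<noteq> 1"
  proof
    assume "exp (2 * pi * \<i> * \<theta>\<^sub>i) * v_zero \<theta>\<^sub>0 = 1"
    then have u: "u = 1 / v ^ 3" using d nz by (simp add: u_def field_simps)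
    show False
      by (rule sing[of "1 / v\<^sup>2"]; (unfold w u)?; use nz(1) in \<open>simp add: eval_nat_numeral field_simps\<close>)
  qed
qed

section \<open>Preimages of lines and curves in the Stokes variety\<close>

context
  fixes \<theta>\<^sub>0 \<theta>\<^sub>i v h d :: complex
  defines "v \<equiv> v_inf \<theta>\<^sub>i" and "h \<equiv> v_zero \<theta>\<^sub>0 + inverse (v_zero \<theta>\<^sub>0)" and "d \<equiv> exp (2 * pi * \<i> * \<theta>\<^sub>i)"
begin

lemma v_nonzero: "v \<noteq> 0" and d_nonzero: "d \<noteq> 0"
  by (simp_all add: v_def d_def v_inf_def)

lemma d_eq: "d = v ^ 3"
  by (simp only: v_def d_def v_inf_cubed)

lemma mem_stokes_variety:
  "(s1, s2, s3, s4) \<in> stokes_variety \<theta>\<^sub>0 \<theta>\<^sub>i \<longleftrightarrow> stokes_relation d h s1 s2 s3 s4"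
proof -
  let ?l = "s1 * s2 * s3 * s4 + s1 * s2 + s1 * s4 + s3 * s4 + s2 * s3 / v ^ 6 - h / v ^ 3 + 1 / v ^ 6 + 1"
  have "?l = (d\<^sup>2 * (s1 * s2 * s3 * s4 + s1 * s2 + s1 * s4 + s3 * s4 + 1) + s2 * s3 + 1 - d * h) / d\<^sup>2"
    using v_nonzero by (simp add: d_eq field_simps eval_nat_numeral)
  then have "?l = 0 \<longleftrightarrow> stokes_relation d h s1 s2 s3 s4"
    using d_nonzero by (simp add: stokes_relation_def)
  then show ?thesis
    by (simp add: stokes_variety_def Let_def v_def h_def)
qed

lemma b_coeff_simps:
  "k mod 3 = 1 \<Longrightarrow> b_coeff \<theta>\<^sub>0 \<theta>\<^sub>i k = v * v_zero \<theta>\<^sub>0"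
  "k mod 3 = 2 \<Longrightarrow> b_coeff \<theta>\<^sub>0 \<theta>\<^sub>i k = v * inverse (v_zero \<theta>\<^sub>0)"
  "k mod 3 = 0 \<Longrightarrow> b_coeff \<theta>\<^sub>0 \<theta>\<^sub>i k = 1 / v\<^sup>2"
  by (simp_all add: b_coeff_def Let_def v_def divide_inverse v_zero_def power2_eq_square)

lemma mem_preimage_line:
  fixes k s1 s2 s3 s4
  defines "c \<equiv> b_coeff \<theta>\<^sub>0 \<theta>\<^sub>i k"
    and "inL \<equiv> (s1, s2, s3, s4) \<in> preimage \<theta>\<^sub>0 \<theta>\<^sub>i (line_L \<theta>\<^sub>0 \<theta>\<^sub>i k)"
    and "R \<equiv> stokes_relation d h s1 s2 s3 s4"
    and "x1 \<equiv> (1 + v ^ 6 * s1 * s4) / v\<^sup>2" and "x2 \<equiv> v\<^sup>2 * (1 + s1 * s2)"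
    and "x3 \<equiv> v\<^sup>2 * (1 + s3 * s4)" and "x4 \<equiv> (1 + s2 * s3) / v\<^sup>2"
  shows "k \<in> {1..3} \<Longrightarrow> inL \<longleftrightarrow> R \<and> x1 = c \<and> x2 = inverse c \<and> x3 + c * x4 = h / v + v\<^sup>2 - inverse c"
    and "k \<in> {4..6} \<Longrightarrow> inL \<longleftrightarrow> R \<and> x1 = c \<and> x3 = inverse c \<and> x2 + c * x4 = h / v + v\<^sup>2 - inverse c"
    and "k \<in> {7..9} \<Longrightarrow> inL \<longleftrightarrow> R \<and> x4 = c \<and> x2 = inverse c \<and> x1 + inverse c * x3 = v * h + 1 / v\<^sup>2 - c"
    and "k \<in> {10..12} \<Longrightarrow> inL \<longleftrightarrow> R \<and> x4 = c \<and> x3 = inverse c \<and> x1 + inverse c * x2 = v * h + 1 / v\<^sup>2 - c"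
proof -
  have pt: "to_surface \<theta>\<^sub>i (s1, s2, s3, s4) = (x1, x2, x3, x4)"
    by (simp add: to_surface_def Let_def v_def x1_def x2_def x3_def x4_def)
  have w: "fst (w_param \<theta>\<^sub>0 \<theta>\<^sub>i) = v * h + 1 / v\<^sup>2" "snd (w_param \<theta>\<^sub>0 \<theta>\<^sub>i) = h / v + v\<^sup>2"
    by (simp_all add: w_param_def Let_def v_def h_def)
  have inL: "inL \<longleftrightarrow> R \<and> (x1, x2, x3, x4) \<in> line_L \<theta>\<^sub>0 \<theta>\<^sub>i k"
    unfolding inL_def preimage_def mem_Collect_eq mem_stokes_variety pt R_def ..
  show "k \<in> {1..3} \<Longrightarrow> inL \<longleftrightarrow> R \<and> x1 = c \<and> x2 = inverse c \<and> x3 + c * x4 = h / v + v\<^sup>2 - inverse c"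
    and "k \<in> {4..6} \<Longrightarrow> inL \<longleftrightarrow> R \<and> x1 = c \<and> x3 = inverse c \<and> x2 + c * x4 = h / v + v\<^sup>2 - inverse c"
    and "k \<in> {7..9} \<Longrightarrow> inL \<longleftrightarrow> R \<and> x4 = c \<and> x2 = inverse c \<and> x1 + inverse c * x3 = v * h + 1 / v\<^sup>2 - c"
    and "k \<in> {10..12} \<Longrightarrow> inL \<longleftrightarrow> R \<and> x4 = c \<and> x3 = inverse c \<and> x1 + inverse c * x2 = v * h + 1 / v\<^sup>2 - c"
    unfolding inL line_L_def Let_def w c_def[symmetric] by auto
qed

text \<open>Since \<open>h\<close> is unchanged under r to 1/r, one statement serves both residues 1
  and 2 of k modulo 3, that is, eight of the lines.\<close>

lemma preimage_lines:
  assumes c: "b_coeff \<theta>\<^sub>0 \<theta>\<^sub>i k = v * r" and "r \<noteq> 0" "h = r + inverse r" "d * r \<noteq> 1" "d \<noteq> r"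
  shows "k \<in> {1..3} \<Longrightarrow> preimage \<theta>\<^sub>0 \<theta>\<^sub>i (line_L \<theta>\<^sub>0 \<theta>\<^sub>i k) =
      {(s1, s2, s3, s4). s2 + d / r * s4 = 0 \<and> 1 + s1 * s2 = 1 / (d * r)}"
    and "k \<in> {4..6} \<Longrightarrow> preimage \<theta>\<^sub>0 \<theta>\<^sub>i (line_L \<theta>\<^sub>0 \<theta>\<^sub>i k) =
      {(s1, s2, s3, s4). s3 + d / r * s1 = 0 \<and> 1 + s3 * s4 = 1 / (d * r)}"
    and "k \<in> {7..9} \<Longrightarrow> preimage \<theta>\<^sub>0 \<theta>\<^sub>i (line_L \<theta>\<^sub>0 \<theta>\<^sub>i k) =
      {(s1, s2, s3, s4). s1 + 1 / (d * r) * s3 = 0 \<and> 1 + s2 * s3 = d * r}"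
    and "k \<in> {10..12} \<Longrightarrow> preimage \<theta>\<^sub>0 \<theta>\<^sub>i (line_L \<theta>\<^sub>0 \<theta>\<^sub>i k) =
      {(s1, s2, s3, s4). s2 + d * r * s4 = 0 \<and> 1 + s3 * s4 = 1 / (d * r)}"
proof -
  note eqs = surface_equations[OF v_nonzero \<open>r \<noteq> 0\<close> d_eq \<open>h = r + inverse r\<close>]
  note lines = line_x1_x2 line_x4_x2 line_x4_x3
  note lines = lines[OF d_nonzero assms(2-5)]
  show "preimage \<theta>\<^sub>0 \<theta>\<^sub>i (line_L \<theta>\<^sub>0 \<theta>\<^sub>i k) =
      {(s1, s2, s3, s4). s2 + d / r * s4 = 0 \<and> 1 + s1 * s2 = 1 / (d * r)}" if k: "k \<in> {1..3}"
    by (rule set_eqI, clarify)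
      (simp only: mem_Collect_eq prod.case mem_preimage_line(1)[OF k] c eqs(1,3,4) lines(1))
  show "preimage \<theta>\<^sub>0 \<theta>\<^sub>i (line_L \<theta>\<^sub>0 \<theta>\<^sub>i k) =
      {(s1, s2, s3, s4). s3 + d / r * s1 = 0 \<and> 1 + s3 * s4 = 1 / (d * r)}" if k: "k \<in> {4..6}"
  proof (intro set_eqI, clarify)
    fix s1 s2 s3 s4
    show "(s1, s2, s3, s4) \<in> preimage \<theta>\<^sub>0 \<theta>\<^sub>i (line_L \<theta>\<^sub>0 \<theta>\<^sub>i k) \<longleftrightarrow>
        (s1, s2, s3, s4) \<in> {(s1, s2, s3, s4). s3 + d / r * s1 = 0 \<and> 1 + s3 * s4 = 1 / (d * r)}"
      unfolding mem_preimage_line(2)[OF k] c eqs(1,3,4)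
      using lines(1)[of s4 s3 s2 s1] stokes_relation_swap[of d h s1 s2 s3 s4] by (auto simp: mult_ac)
  qed
  show "preimage \<theta>\<^sub>0 \<theta>\<^sub>i (line_L \<theta>\<^sub>0 \<theta>\<^sub>i k) =
      {(s1, s2, s3, s4). s1 + 1 / (d * r) * s3 = 0 \<and> 1 + s2 * s3 = d * r}" if k: "k \<in> {7..9}"
    by (rule set_eqI, clarify)
      (simp only: mem_Collect_eq prod.case mem_preimage_line(3)[OF k] c eqs(2,3,5) lines(2))
  show "preimage \<theta>\<^sub>0 \<theta>\<^sub>i (line_L \<theta>\<^sub>0 \<theta>\<^sub>i k) =
      {(s1, s2, s3, s4). s2 + d * r * s4 = 0 \<and> 1 + s3 * s4 = 1 / (d * r)}" if k: "k \<in> {10..12}"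
    by (rule set_eqI, clarify)
      (simp only: mem_Collect_eq prod.case mem_preimage_line(4)[OF k] c eqs(2,3,5) lines(3))
qed

lemma preimage_lines_coordinate:
  assumes c: "b_coeff \<theta>\<^sub>0 \<theta>\<^sub>i k = 1 / v\<^sup>2" and nonsing: "d * v_zero \<theta>\<^sub>0 \<noteq> 1" "d \<noteq> v_zero \<theta>\<^sub>0"
  shows "k \<in> {1..3} \<Longrightarrow> preimage \<theta>\<^sub>0 \<theta>\<^sub>i (line_L \<theta>\<^sub>0 \<theta>\<^sub>i k) = {(s1, s2, s3, s4). s1 = 0} \<inter> stokes_variety \<theta>\<^sub>0 \<theta>\<^sub>i"
    and "k \<in> {4..6} \<Longrightarrow> preimage \<theta>\<^sub>0 \<theta>\<^sub>i (line_L \<theta>\<^sub>0 \<theta>\<^sub>i k) = {(s1, s2, s3, s4). s4 = 0} \<inter> stokes_variety \<theta>\<^sub>0 \<theta>\<^sub>i"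
    and "k \<in> {7..9} \<Longrightarrow> preimage \<theta>\<^sub>0 \<theta>\<^sub>i (line_L \<theta>\<^sub>0 \<theta>\<^sub>i k) = {(s1, s2, s3, s4). s2 = 0} \<inter> stokes_variety \<theta>\<^sub>0 \<theta>\<^sub>i"
    and "k \<in> {10..12} \<Longrightarrow> preimage \<theta>\<^sub>0 \<theta>\<^sub>i (line_L \<theta>\<^sub>0 \<theta>\<^sub>i k) = {(s1, s2, s3, s4). s3 = 0} \<inter> stokes_variety \<theta>\<^sub>0 \<theta>\<^sub>i"
proof -
  have u: "v_zero \<theta>\<^sub>0 \<noteq> 0" by (simp add: v_zero_def)
  have hu: "h = v_zero \<theta>\<^sub>0 + inverse (v_zero \<theta>\<^sub>0)" by (simp add: h_def)
  have ic: "inverse (1 / v\<^sup>2) = v\<^sup>2" by simp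
  note eqs = surface_equations[OF v_nonzero u d_eq hu]
  note lines = line_s1 line_s2
  note lines = lines[OF d_nonzero u hu nonsing]
  show "preimage \<theta>\<^sub>0 \<theta>\<^sub>i (line_L \<theta>\<^sub>0 \<theta>\<^sub>i k) = {(s1, s2, s3, s4). s1 = 0} \<inter> stokes_variety \<theta>\<^sub>0 \<theta>\<^sub>i" if k: "k \<in> {1..3}"
  proof (intro set_eqI, clarify)
    fix s1 s2 s3 s4
    show "(s1, s2, s3, s4) \<in> preimage \<theta>\<^sub>0 \<theta>\<^sub>i (line_L \<theta>\<^sub>0 \<theta>\<^sub>i k) \<longleftrightarrow>
        (s1, s2, s3, s4) \<in> {(s1, s2, s3, s4). s1 = 0} \<inter> stokes_variety \<theta>\<^sub>0 \<theta>\<^sub>i"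
      unfolding mem_preimage_line(1)[OF k] c ic eqs(6,8,9) Int_iff mem_stokes_variety using lines(1) by auto
  qed
  show "preimage \<theta>\<^sub>0 \<theta>\<^sub>i (line_L \<theta>\<^sub>0 \<theta>\<^sub>i k) = {(s1, s2, s3, s4). s4 = 0} \<inter> stokes_variety \<theta>\<^sub>0 \<theta>\<^sub>i" if k: "k \<in> {4..6}"
  proof (intro set_eqI, clarify)
    fix s1 s2 s3 s4
    show "(s1, s2, s3, s4) \<in> preimage \<theta>\<^sub>0 \<theta>\<^sub>i (line_L \<theta>\<^sub>0 \<theta>\<^sub>i k) \<longleftrightarrow>
        (s1, s2, s3, s4) \<in> {(s1, s2, s3, s4). s4 = 0} \<inter> stokes_variety \<theta>\<^sub>0 \<theta>\<^sub>i"
      unfolding mem_preimage_line(2)[OF k] c ic eqs(6,8,9) Int_iff mem_stokes_variety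
      using lines(1)[of s4 s3 s2 s1] stokes_relation_swap[of d h s1 s2 s3 s4] by (auto simp: mult_ac)
  qed
  show "preimage \<theta>\<^sub>0 \<theta>\<^sub>i (line_L \<theta>\<^sub>0 \<theta>\<^sub>i k) = {(s1, s2, s3, s4). s2 = 0} \<inter> stokes_variety \<theta>\<^sub>0 \<theta>\<^sub>i" if k: "k \<in> {7..9}"
  proof (intro set_eqI, clarify)
    fix s1 s2 s3 s4
    show "(s1, s2, s3, s4) \<in> preimage \<theta>\<^sub>0 \<theta>\<^sub>i (line_L \<theta>\<^sub>0 \<theta>\<^sub>i k) \<longleftrightarrow>
        (s1, s2, s3, s4) \<in> {(s1, s2, s3, s4). s2 = 0} \<inter> stokes_variety \<theta>\<^sub>0 \<theta>\<^sub>i"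
      unfolding mem_preimage_line(3)[OF k] c ic eqs(7,8,10) Int_iff mem_stokes_variety using lines(2) by auto
  qed
  show "preimage \<theta>\<^sub>0 \<theta>\<^sub>i (line_L \<theta>\<^sub>0 \<theta>\<^sub>i k) = {(s1, s2, s3, s4). s3 = 0} \<inter> stokes_variety \<theta>\<^sub>0 \<theta>\<^sub>i" if k: "k \<in> {10..12}"
  proof (intro set_eqI, clarify)
    fix s1 s2 s3 s4
    show "(s1, s2, s3, s4) \<in> preimage \<theta>\<^sub>0 \<theta>\<^sub>i (line_L \<theta>\<^sub>0 \<theta>\<^sub>i k) \<longleftrightarrow>
        (s1, s2, s3, s4) \<in> {(s1, s2, s3, s4). s3 = 0} \<inter> stokes_variety \<theta>\<^sub>0 \<theta>\<^sub>i"
      unfolding mem_preimage_line(4)[OF k] c ic eqs(7,8,10) Int_iff mem_stokes_variety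
      using lines(2)[of s4 s3 s2 s1] stokes_relation_swap[of d h s1 s2 s3 s4] by (auto simp: mult_ac)
  qed
qed

text \<open>Both defining polynomials of the surface pull back to the Stokes relation divided by a
  power of \<open>v\<close>. The curves need this because they are cut out inside the
  surface.\<close>

lemma to_surface_mem:
  assumes "(s1, s2, s3, s4) \<in> stokes_variety \<theta>\<^sub>0 \<theta>\<^sub>i"
  shows "to_surface \<theta>\<^sub>i (s1, s2, s3, s4) \<in> monodromy_surface (w_param \<theta>\<^sub>0 \<theta>\<^sub>i)"
proof -
  have R: "d\<^sup>2 * (s1 * s2 * s3 * s4 + s1 * s2 + s1 * s4 + s3 * s4 + 1) + s2 * s3 + 1 = d * h"
    using assms unfolding mem_stokes_variety stokes_relation_def .
  have "v\<^sup>2 * (1 + s1 * s2) * (v\<^sup>2 * (1 + s3 * s4)) + (1 + v ^ 6 * s1 * s4) / v\<^sup>2 + (1 + s2 * s3) / v\<^sup>2 - (v * h + 1 / v\<^sup>2) =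
      (d\<^sup>2 * (s1 * s2 * s3 * s4 + s1 * s2 + s1 * s4 + s3 * s4 + 1) + s2 * s3 + 1 - d * h) / v\<^sup>2"
    using v_nonzero by (simp add: d_eq field_simps eval_nat_numeral)
  moreover have "(1 + v ^ 6 * s1 * s4) / v\<^sup>2 * ((1 + s2 * s3) / v\<^sup>2) + v\<^sup>2 * (1 + s1 * s2) + v\<^sup>2 * (1 + s3 * s4) - (h / v + v\<^sup>2) =
      (d\<^sup>2 * (s1 * s2 * s3 * s4 + s1 * s2 + s1 * s4 + s3 * s4 + 1) + s2 * s3 + 1 - d * h) / v ^ 4"
    using v_nonzero by (simp add: d_eq field_simps eval_nat_numeral)
  ultimately show ?thesis
    unfolding R by (simp add: to_surface_def monodromy_surface_def w_param_def Let_def flip: v_def h_def)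
qed

lemma preimage_curves:
  "preimage \<theta>\<^sub>0 \<theta>\<^sub>i (curve_C \<theta>\<^sub>0 \<theta>\<^sub>i 1) = {(s1, s2, s3, s4). s1 * s4 + 1 / d\<^sup>2 = 0} \<inter> stokes_variety \<theta>\<^sub>0 \<theta>\<^sub>i"
  "preimage \<theta>\<^sub>0 \<theta>\<^sub>i (curve_C \<theta>\<^sub>0 \<theta>\<^sub>i 2) = {(s1, s2, s3, s4). s1 * s2 + 1 = 0} \<inter> stokes_variety \<theta>\<^sub>0 \<theta>\<^sub>i"
  "preimage \<theta>\<^sub>0 \<theta>\<^sub>i (curve_C \<theta>\<^sub>0 \<theta>\<^sub>i 3) = {(s1, s2, s3, s4). s3 * s4 + 1 = 0} \<inter> stokes_variety \<theta>\<^sub>0 \<theta>\<^sub>i"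
  "preimage \<theta>\<^sub>0 \<theta>\<^sub>i (curve_C \<theta>\<^sub>0 \<theta>\<^sub>i 4) = {(s1, s2, s3, s4). s2 * s3 + 1 = 0} \<inter> stokes_variety \<theta>\<^sub>0 \<theta>\<^sub>i"
proof -
  have 1: "1 + v ^ 6 * s1 * s4 = 0 \<longleftrightarrow> s1 * s4 + 1 / d\<^sup>2 = 0" for s1 s4
    using v_nonzero by (simp add: d_eq field_simps flip: power_mult)
  have mem: "(s1, s2, s3, s4) \<in> preimage \<theta>\<^sub>0 \<theta>\<^sub>i (curve_C \<theta>\<^sub>0 \<theta>\<^sub>i j) \<longleftrightarrow>
      (s1, s2, s3, s4) \<in> stokes_variety \<theta>\<^sub>0 \<theta>\<^sub>i \<and> j \<in> {1..4} \<and>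
      [(1 + v ^ 6 * s1 * s4) / v\<^sup>2, v\<^sup>2 * (1 + s1 * s2), v\<^sup>2 * (1 + s3 * s4), (1 + s2 * s3) / v\<^sup>2] ! (j - 1) = 0"
    for s1 s2 s3 s4 j
    using to_surface_mem[of s1 s2 s3 s4]
    by (auto simp: preimage_def curve_C_def to_surface_def Let_def simp flip: v_def)
  show "preimage \<theta>\<^sub>0 \<theta>\<^sub>i (curve_C \<theta>\<^sub>0 \<theta>\<^sub>i 1) = {(s1, s2, s3, s4). s1 * s4 + 1 / d\<^sup>2 = 0} \<inter> stokes_variety \<theta>\<^sub>0 \<theta>\<^sub>i"
    "preimage \<theta>\<^sub>0 \<theta>\<^sub>i (curve_C \<theta>\<^sub>0 \<theta>\<^sub>i 2) = {(s1, s2, s3, s4). s1 * s2 + 1 = 0} \<inter> stokes_variety \<theta>\<^sub>0 \<theta>\<^sub>i"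
    "preimage \<theta>\<^sub>0 \<theta>\<^sub>i (curve_C \<theta>\<^sub>0 \<theta>\<^sub>i 3) = {(s1, s2, s3, s4). s3 * s4 + 1 = 0} \<inter> stokes_variety \<theta>\<^sub>0 \<theta>\<^sub>i"
    "preimage \<theta>\<^sub>0 \<theta>\<^sub>i (curve_C \<theta>\<^sub>0 \<theta>\<^sub>i 4) = {(s1, s2, s3, s4). s2 * s3 + 1 = 0} \<inter> stokes_variety \<theta>\<^sub>0 \<theta>\<^sub>i"
    using v_nonzero by (auto simp: mem 1 add.commute)
qed

end

lemma exp_parameters:
  fixes \<theta>\<^sub>0 \<theta>\<^sub>i :: complex
  defines "d \<equiv> exp (2 * pi * \<i> * \<theta>\<^sub>i)" and "v0 \<equiv> v_zero \<theta>\<^sub>0"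
  shows "exp (2 * pi * \<i> * (\<theta>\<^sub>i - \<theta>\<^sub>0)) = d / v0"
    and "exp (2 * pi * \<i> * (\<theta>\<^sub>i + \<theta>\<^sub>0)) = d * v0"
    and "exp (2 * pi * \<i> * (- (\<theta>\<^sub>i + \<theta>\<^sub>0))) = 1 / (d * v0)"
    and "exp (2 * pi * \<i> * (- (\<theta>\<^sub>i - \<theta>\<^sub>0))) = v0 / d"
  by (simp_all add: d_def v0_def v_zero_def ring_distribs exp_add exp_diff exp_minus divide_inverse)

lemma preimage_line_L:
  fixes \<theta>\<^sub>0 \<theta>\<^sub>i :: complex
  assumes "w_param \<theta>\<^sub>0 \<theta>\<^sub>i \<notin> W_sing"
  defines "d \<equiv> exp (2 * pi * \<i> * \<theta>\<^sub>i)" and "v0 \<equiv> v_zero \<theta>\<^sub>0"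
    and "M \<equiv> stokes_variety \<theta>\<^sub>0 \<theta>\<^sub>i" and "preL \<equiv> \<lambda>k. preimage \<theta>\<^sub>0 \<theta>\<^sub>i (line_L \<theta>\<^sub>0 \<theta>\<^sub>i k)"
  shows "preL 1 = {(s1, s2, s3, s4). s2 + d / v0 * s4 = 0 \<and> 1 + s1 * s2 = 1 / (d * v0)}"
    and "preL 2 = {(s1, s2, s3, s4). s2 + d * v0 * s4 = 0 \<and> 1 + s1 * s2 = v0 / d}"
    and "preL 3 = {(s1, s2, s3, s4). s1 = 0} \<inter> M"
    and "preL 4 = {(s1, s2, s3, s4). s3 + d / v0 * s1 = 0 \<and> 1 + s3 * s4 = 1 / (d * v0)}"
    and "preL 5 = {(s1, s2, s3, s4). s3 + d * v0 * s1 = 0 \<and> 1 + s3 * s4 = v0 / d}"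
    and "preL 6 = {(s1, s2, s3, s4). s4 = 0} \<inter> M"
    and "preL 7 = {(s1, s2, s3, s4). s1 + 1 / (d * v0) * s3 = 0 \<and> 1 + s2 * s3 = d * v0}"
    and "preL 8 = {(s1, s2, s3, s4). s1 + v0 / d * s3 = 0 \<and> 1 + s2 * s3 = d / v0}"
    and "preL 9 = {(s1, s2, s3, s4). s2 = 0} \<inter> M"
    and "preL 10 = {(s1, s2, s3, s4). s2 + d * v0 * s4 = 0 \<and> 1 + s3 * s4 = 1 / (d * v0)}"
    and "preL 11 = {(s1, s2, s3, s4). s2 + d / v0 * s4 = 0 \<and> 1 + s3 * s4 = v0 / d}"
    and "preL 12 = {(s1, s2, s3, s4). s3 = 0} \<inter> M"
proof -
  have nz: "d \<noteq> 0" "v0 \<noteq> 0" "inverse v0 \<noteq> 0"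
    by (simp_all add: d_def v0_def v_zero_def)
  note ns = w_param_nonsingular[OF assms(1), folded d_def v0_def]
  \<comment> \<open>Replacing v_0 by its inverse interchanges the two nondegeneracy
    conditions.\<close>
  have dr: "d * inverse v0 \<noteq> 1" "d \<noteq> inverse v0"
    using ns nz by (auto simp: field_simps)
  have h: "v0 + inverse v0 = inverse v0 + inverse (inverse v0)"
    by simp
  have ratios: "d / inverse v0 = d * v0" "1 / (d / v0) = v0 / d" "d * inverse v0 = d / v0"
    by (simp_all add: field_simps)
  have preL: "preimage \<theta>\<^sub>0 \<theta>\<^sub>i (line_L \<theta>\<^sub>0 \<theta>\<^sub>i k) = preL k" for k
    by (simp add: preL_def)
  \<comment> \<open>\<open>L1\<close>, \<open>L2\<close> and \<open>L3\<close> cover k congruent to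
    1, 2 and 0 modulo 3.\<close>
  note L1 = preimage_lines[where r = v0 and \<theta>\<^sub>0 = \<theta>\<^sub>0 and \<theta>\<^sub>i = \<theta>\<^sub>i, folded d_def v0_def, unfolded preL, OF _ nz(2) refl ns(3,2)]
  note L2 = preimage_lines[where r = "inverse v0" and \<theta>\<^sub>0 = \<theta>\<^sub>0 and \<theta>\<^sub>i = \<theta>\<^sub>i, folded d_def v0_def, unfolded preL,
      OF _ nz(3) h dr, unfolded ratios]
  note L3 = preimage_lines_coordinate[where \<theta>\<^sub>0 = \<theta>\<^sub>0 and \<theta>\<^sub>i = \<theta>\<^sub>i, folded d_def v0_def M_def, unfolded preL, OF _ ns(3,2)]
  note b = b_coeff_simps[where \<theta>\<^sub>i = \<theta>\<^sub>i and \<theta>\<^sub>0 = \<theta>\<^sub>0, folded v0_def]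
  show "preL 1 = {(s1, s2, s3, s4). s2 + d / v0 * s4 = 0 \<and> 1 + s1 * s2 = 1 / (d * v0)}"
    by (rule L1(1)[OF b(1)]) simp_all
  show "preL 2 = {(s1, s2, s3, s4). s2 + d * v0 * s4 = 0 \<and> 1 + s1 * s2 = v0 / d}"
    by (rule L2(1)[OF b(2)]) simp_all
  show "preL 3 = {(s1, s2, s3, s4). s1 = 0} \<inter> M"
    by (rule L3(1)[OF b(3)]) simp_all
  show "preL 4 = {(s1, s2, s3, s4). s3 + d / v0 * s1 = 0 \<and> 1 + s3 * s4 = 1 / (d * v0)}"
    by (rule L1(2)[OF b(1)]) simp_all
  show "preL 5 = {(s1, s2, s3, s4). s3 + d * v0 * s1 = 0 \<and> 1 + s3 * s4 = v0 / d}"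
    by (rule L2(2)[OF b(2)]) simp_all
  show "preL 6 = {(s1, s2, s3, s4). s4 = 0} \<inter> M"
    by (rule L3(2)[OF b(3)]) simp_all
  show "preL 7 = {(s1, s2, s3, s4). s1 + 1 / (d * v0) * s3 = 0 \<and> 1 + s2 * s3 = d * v0}"
    by (rule L1(3)[OF b(1)]) simp_all
  show "preL 8 = {(s1, s2, s3, s4). s1 + v0 / d * s3 = 0 \<and> 1 + s2 * s3 = d / v0}"
    by (rule L2(3)[OF b(2)]) simp_all
  show "preL 9 = {(s1, s2, s3, s4). s2 = 0} \<inter> M"
    by (rule L3(3)[OF b(3)]) simp_all
  show "preL 10 = {(s1, s2, s3, s4). s2 + d * v0 * s4 = 0 \<and> 1 + s3 * s4 = 1 / (d * v0)}"
    by (rule L1(4)[OF b(1)]) simp_all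
  show "preL 11 = {(s1, s2, s3, s4). s2 + d / v0 * s4 = 0 \<and> 1 + s3 * s4 = v0 / d}"
    by (rule L2(4)[OF b(2)]) simp_all
  show "preL 12 = {(s1, s2, s3, s4). s3 = 0} \<inter> M"
    by (rule L3(4)[OF b(3)]) simp_all
qed

section \<open>Stokes data\<close>

text \<open>The left sides are the third quantisation condition for k = 1, 3, 4 and 2, in the order
  A, C, D, B, with s_5, s_6, s_7 expressed by s_1, s_2, s_3. With c = v_0 the right sides A to D are
  L_11, L_4, L_2, L_7; with c = 1/v_0 they are L_10, L_5, L_1, L_8.\<close>

lemma quantisation_3_lines:
  fixes c d s1 s2 s3 s4 :: complex
  assumes "c \<noteq> 0" "d \<noteq> 0"
  shows "s2 + s4 + s2 * s3 * s4 = 0 \<and> c = d * (1 + s3 * s4) \<longleftrightarrow>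
      s2 + d / c * s4 = 0 \<and> 1 + s3 * s4 = c / d" (is ?A)
    and "s3 + s1 * d\<^sup>2 + s3 * s4 * (s1 * d\<^sup>2) = 0 \<and> c = inverse d * (1 + s4 * (s1 * d\<^sup>2)) \<longleftrightarrow>
      s3 + d / c * s1 = 0 \<and> 1 + s3 * s4 = 1 / (d * c)" (is ?B)
    and "s4 + s2 * (inverse d)\<^sup>2 + s4 * (s1 * d\<^sup>2) * (s2 * (inverse d)\<^sup>2) = 0 \<and>
        c = d * (1 + s1 * d\<^sup>2 * (s2 * (inverse d)\<^sup>2)) \<longleftrightarrow>
      s2 + d * c * s4 = 0 \<and> 1 + s1 * s2 = c / d" (is ?C)
    and "s1 * d\<^sup>2 + s3 * d\<^sup>2 + s1 * d\<^sup>2 * (s2 * (inverse d)\<^sup>2) * (s3 * d\<^sup>2) = 0 \<and>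
        c = inverse d * (1 + s2 * (inverse d)\<^sup>2 * (s3 * d\<^sup>2)) \<longleftrightarrow>
      s1 + 1 / (d * c) * s3 = 0 \<and> 1 + s2 * s3 = d * c" (is ?D)
proof -
  have q1: "x + d / c * y = 0 \<longleftrightarrow> c * x + d * y = 0" for x y
    using assms by (simp add: field_simps)
  have q2: "x = c / d \<longleftrightarrow> d * x = c" for x
    using assms by (auto simp: field_simps)
  have q3: "x = 1 / (d * c) \<longleftrightarrow> d * c * x = 1" for x
    using assms by (auto simp: field_simps)
  have q4: "x + 1 / (d * c) * y = 0 \<longleftrightarrow> d * c * x + y = 0" for x y
    using assms by (simp add: field_simps)
  have q5: "c = inverse d * x \<longleftrightarrow> d * c = x" for x
    using assms by (auto simp: field_simps)
  have q6: "x * d\<^sup>2 * (y * (inverse d)\<^sup>2) = x * y" "x * (inverse d)\<^sup>2 * (y * d\<^sup>2) = x * y" for x y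
    using assms by (simp_all add: field_simps)
  have q7: "s4 + s2 * (inverse d)\<^sup>2 + s4 * (s1 * d\<^sup>2) * (s2 * (inverse d)\<^sup>2) = 0 \<longleftrightarrow>
      d\<^sup>2 * s4 * (1 + s1 * s2) + s2 = 0"
  proof -
    have "s4 + s2 * (inverse d)\<^sup>2 + s4 * (s1 * d\<^sup>2) * (s2 * (inverse d)\<^sup>2) =
        (inverse d)\<^sup>2 * (d\<^sup>2 * s4 * (1 + s1 * s2) + s2)"
      using assms by (simp add: field_simps)
    then show ?thesis using assms by simp
  qed
  have q8: "s1 * d\<^sup>2 + s3 * d\<^sup>2 + s1 * d\<^sup>2 * (s2 * (inverse d)\<^sup>2) * (s3 * d\<^sup>2) = 0 \<longleftrightarrow>
      s1 + s3 + s1 * s2 * s3 = 0"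
  proof -
    have "s1 * d\<^sup>2 + s3 * d\<^sup>2 + s1 * d\<^sup>2 * (s2 * (inverse d)\<^sup>2) * (s3 * d\<^sup>2) =
        d\<^sup>2 * (s1 + s3 + s1 * s2 * s3)"
      using assms by (simp add: field_simps)
    then show ?thesis using assms by simp
  qed
  show ?A
    unfolding q1 q2
  proof (intro iffI conjI; elim conjE)
    assume "s2 + s4 + s2 * s3 * s4 = 0" "c = d * (1 + s3 * s4)"
    then show "c * s2 + d * s4 = 0" by algebra
  next
    assume "c * s2 + d * s4 = 0" "d * (1 + s3 * s4) = c"
    then have "d * (s2 + s4 + s2 * s3 * s4) = 0" by algebra
    then show "s2 + s4 + s2 * s3 * s4 = 0" using assms by simp
  qed auto
  show ?B
    unfolding q1 q3 q5
  proof (intro iffI conjI; elim conjE)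
    assume a: "s3 + s1 * d\<^sup>2 + s3 * s4 * (s1 * d\<^sup>2) = 0" "d * c = 1 + s4 * (s1 * d\<^sup>2)"
    have "d * (c * s3 + d * s1) = 0" using a by algebra
    then show b: "c * s3 + d * s1 = 0" using assms by simp
    show "d * c * (1 + s3 * s4) = 1" using a(2) b by algebra
  next
    assume a: "c * s3 + d * s1 = 0" "d * c * (1 + s3 * s4) = 1"
    show b: "d * c = 1 + s4 * (s1 * d\<^sup>2)" using a by algebra
    show "s3 + s1 * d\<^sup>2 + s3 * s4 * (s1 * d\<^sup>2) = 0" using a(1) b by algebra
  qed
  show ?C
    unfolding q2 q6 q7
  proof (intro iffI conjI; elim conjE)
    assume a: "d\<^sup>2 * s4 * (1 + s1 * s2) + s2 = 0" "c = d * (1 + s1 * s2)"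
    then show "d * (1 + s1 * s2) = c" by simp
    show "s2 + d * c * s4 = 0" using a by algebra
  next
    assume a: "s2 + d * c * s4 = 0" "d * (1 + s1 * s2) = c"
    then show "c = d * (1 + s1 * s2)" by simp
    show "d\<^sup>2 * s4 * (1 + s1 * s2) + s2 = 0" using a by algebra
  qed
  show ?D
    unfolding q8 q4 q5
    unfolding q6
  proof (intro iffI conjI; elim conjE)
    assume a: "s1 + s3 + s1 * s2 * s3 = 0" "d * c = 1 + s2 * s3"
    then show "1 + s2 * s3 = d * c" by simp
    show "d * c * s1 + s3 = 0" using a by algebra
  next
    assume a: "d * c * s1 + s3 = 0" "1 + s2 * s3 = d * c"
    then show "d * c = 1 + s2 * s3" by simp
    show "s1 + s3 + s1 * s2 * s3 = 0" using a by algebra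
  qed
qed

text \<open>The factor by which \<open>z\<^bsup>\<mp>\<theta>\<^esup>\<close> changes when \<open>z\<close> is replaced by \<open>e\<^bsup>-2\<pi>i\<^esup>z\<close>.\<close>

definition multiplier :: "complex \<Rightarrow> int \<Rightarrow> complex" where
  "multiplier \<theta>\<^sub>i k =
     (if odd k then exp (2 * pi * \<i> * \<theta>\<^sub>i) else inverse (exp (2 * pi * \<i> * \<theta>\<^sub>i)))"

lemma multiplier_nonzero [simp]: "multiplier \<theta>\<^sub>i k \<noteq> 0"
  by (simp add: multiplier_def)

section \<open>Recurrence, translation and periodicity\<close>

context
  fixes \<theta>\<^sub>0 \<theta>\<^sub>i t :: complex and A\<^sub>0 A\<^sub>m :: "complex^2^2" and U :: "nat \<Rightarrow> complex^2^2"
    and Y :: "int \<Rightarrow> complex \<Rightarrow> complex^2^2" and \<Psi> :: "int \<Rightarrow> complex \<Rightarrow> complex^2" and s :: "int \<Rightarrow> complex"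
  assumes data: "stokes_data \<theta>\<^sub>0 \<theta>\<^sub>i A\<^sub>0 A\<^sub>m t U Y \<Psi> s"
begin

lemma traces: "trace A\<^sub>0 = 0" "trace A\<^sub>m = 0"
  and residue_eigenvalues: "eigenvalues A\<^sub>m = {\<theta>\<^sub>0, - \<theta>\<^sub>0}"
  and stokes: "Y (k + 1) \<zeta> = Y k \<zeta> ** stokes_matrix k (s k)"
  and solution_Y: "is_solution A\<^sub>0 A\<^sub>m (\<lambda>\<zeta>. column j (Y k \<zeta>))"
  and solution_\<Psi>: "is_solution A\<^sub>0 A\<^sub>m (\<Psi> k)"
  using data
  by (auto simp: stokes_data_def linear_problem_def is_canonical_solution_def is_column_solution_def)

lemma U_0: "U 0 = mat 1"
  using data by (simp add: stokes_data_def is_formal_solution_def)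

lemma ray_Y: "m = k \<or> m = k + 1 \<Longrightarrow> ray_asymptotic \<theta>\<^sub>i t m j 1 (\<lambda>\<zeta>. column j (Y k \<zeta>))"
  using data U_0
  by (intro asymptotic_to_column_imp_ray[of _ _ U "sector k \<union> sector (k + 1)"])
    (auto simp: stokes_data_def is_canonical_solution_def)

text \<open>For either parity the column of \<Psi>_k is the one that decays in the middle sector k +
  1; in the two outer sectors it is dominant.\<close>

lemma ray_\<Psi>: "m = k \<or> m = k + 1 \<or> m = k + 2 \<Longrightarrow> ray_asymptotic \<theta>\<^sub>i t m (recessive (k + 1)) 1 (\<Psi> k)"
  using data U_0
  by (intro asymptotic_to_column_imp_ray[of _ _ U "sector k \<union> sector (k + 1) \<union> sector (k + 2)"])
    (auto simp: stokes_data_def is_column_solution_def recessive_def)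

lemma column_Y_Suc: "\<Psi> k \<zeta> = column (recessive (k + 1)) (Y (k + 1) \<zeta>)"
  using recessive_solution_unique[OF traces solution_\<Psi> ray_\<Psi>[of "k + 1" k] solution_Y ray_Y[of "k + 1" "k + 1"]]
  by simp

text \<open>The triangular shape of S_k leaves exactly this column unchanged.\<close>

lemma column_Y: "\<Psi> k \<zeta> = column (recessive (k + 1)) (Y k \<zeta>)"
  unfolding column_Y_Suc stokes
  by (simp add: recessive_def stokes_matrix_def column_def vec_eq_iff forall_2 matrix_matrix_mult_def sum_2)

lemma \<Psi>_recurrence: "\<Psi> (k + 1) \<zeta> = \<Psi> (k - 1) \<zeta> + s k *s \<Psi> k \<zeta>"
proof -
  have "\<Psi> (k - 1) \<zeta> = column (recessive k) (Y k \<zeta>)"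
    using column_Y_Suc[of "k - 1"] by simp
  moreover have "\<Psi> (k + 1) \<zeta> = column (recessive (k + 2)) (Y k \<zeta> ** stokes_matrix k (s k))"
    using column_Y[of "k + 1"] by (simp add: stokes add.assoc)
  ultimately show ?thesis
    unfolding column_Y[of k]
    by (auto simp: recessive_def stokes_matrix_def column_def vec_eq_iff forall_2 matrix_matrix_mult_def sum_2)
qed

lemma wronskian_\<Psi>: "wronskian (\<Psi> k \<zeta>) (\<Psi> (k + 1) \<zeta>) \<noteq> 0"
proof (cases "even k")
  case True
  have "wronskian (\<Psi> (k + 1) \<zeta>) (\<Psi> k \<zeta>) = 1"
    using wronskian_columns[OF traces solution_\<Psi>[of "k + 1"] solution_\<Psi>[of k], of \<theta>\<^sub>i t "k + 1" 1 1 \<zeta>]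
      ray_\<Psi>[of "k + 1" k] ray_\<Psi>[of "k + 1" "k + 1"] True
    by (simp add: recessive_def)
  then show ?thesis by (auto simp: wronskian_def mult.commute)
next
  case False
  then show ?thesis
    using wronskian_columns[OF traces solution_\<Psi>[of k] solution_\<Psi>[of "k + 1"], of \<theta>\<^sub>i t "k + 1" 1 1 \<zeta>]
      ray_\<Psi>[of "k + 1" k] ray_\<Psi>[of "k + 1" "k + 1"]
    by (simp add: recessive_def)
qed

text \<open>As an equivalence at a single point, this converts each quantisation condition into an
  equality of coefficients that do not involve \<zeta>.\<close>

lemma \<Psi>_independent:
  "a *s \<Psi> k \<zeta> + b *s \<Psi> (k + 1) \<zeta> = a' *s \<Psi> k \<zeta> + b' *s \<Psi> (k + 1) \<zeta> \<longleftrightarrow> a = a' \<and> b = b'"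
proof
  let ?u = "\<Psi> k \<zeta>" and ?v = "\<Psi> (k + 1) \<zeta>"
  assume eq: "a *s ?u + b *s ?v = a' *s ?u + b' *s ?v"
  have "wronskian (a *s ?u + b *s ?v) ?v = a * wronskian ?u ?v"
    "wronskian ?u (a *s ?u + b *s ?v) = b * wronskian ?u ?v" for a b
    by (simp_all add: wronskian_def algebra_simps)
  then have "a * wronskian ?u ?v = a' * wronskian ?u ?v" "b * wronskian ?u ?v = b' * wronskian ?u ?v"
    using eq by metis+
  with wronskian_\<Psi> show "a = a' \<and> b = b'" by simp
qed simp

text \<open>\<Psi>_k decays on ray k + 1, so its translate decays on ray k + 5, as \<Psi>_(k+4)
  does; uniqueness of the recessive solution leaves the constant.\<close>

lemma \<Psi>_translate: "\<Psi> k (\<zeta> - 2 * pi * \<i>) = multiplier \<theta>\<^sub>i k *s \<Psi> (k + 4) \<zeta>"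
proof -
  have r: "recessive (k + 5) = recessive (k + 1)"
    by (simp add: recessive_def)
  let ?c = "exp (sigma3 $ recessive (k + 1) $ recessive (k + 1) * (2 * pi * \<i> * \<theta>\<^sub>i))"
  have "ray_asymptotic \<theta>\<^sub>i t (k + 5) (recessive (k + 5)) ?c (\<lambda>\<zeta>. \<Psi> k (\<zeta> - 2 * pi * \<i>))"
    using ray_asymptotic_translate[OF ray_\<Psi>[of "k + 1" k]] unfolding r by (simp add: add.assoc)
  then have "\<Psi> k (\<zeta> - 2 * pi * \<i>) = ?c *s column (recessive (k + 5)) (Y (k + 5) \<zeta>)"
    using recessive_solution_unique[OF traces is_solution_translate[OF solution_\<Psi>] _ solution_Y ray_Y[of "k + 5" "k + 5"]]
    by simp
  also have "column (recessive (k + 5)) (Y (k + 5) \<zeta>) = \<Psi> (k + 4) \<zeta>"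
    using column_Y_Suc[of "k + 4"] by (simp add: add.assoc)
  also have "?c = multiplier \<theta>\<^sub>i k"
    by (simp add: multiplier_def recessive_def sigma3_def exp_minus)
  finally show ?thesis .
qed

lemma \<Psi>_recurrence_steps:
  "\<Psi> (k + 2) \<zeta> = s (k + 1) *s \<Psi> (k - 1) \<zeta> + (1 + s k * s (k + 1)) *s \<Psi> k \<zeta>"
  "\<Psi> (k + 4) \<zeta> = (1 + s (k + 2) * s (k + 3)) *s \<Psi> k \<zeta> +
      (s (k + 1) + s (k + 3) + s (k + 1) * s (k + 2) * s (k + 3)) *s \<Psi> (k + 1) \<zeta>"
  using \<Psi>_recurrence[of k \<zeta>] \<Psi>_recurrence[of "k + 1" \<zeta>] \<Psi>_recurrence[of "k + 2" \<zeta>] \<Psi>_recurrence[of "k + 3" \<zeta>]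
  by (simp_all add: vec_eq_iff forall_2 algebra_simps)

text \<open>The scalar form of S_(k+4) = D S_k D^(-1) with D = D_infinity. Translating the
  recurrence by a full turn gives the one at k + 4 with rescaled terms; neighbouring multipliers are
  inverse to each other, whence the square.\<close>

lemma stokes_multiplier_periodic: "s (k + 4) = s k * multiplier \<theta>\<^sub>i k ^ 2"
proof -
  have "multiplier \<theta>\<^sub>i (k + 1) *s \<Psi> (k + 5) \<zeta> = multiplier \<theta>\<^sub>i (k - 1) *s \<Psi> (k + 3) \<zeta> + (s k * multiplier \<theta>\<^sub>i k) *s \<Psi> (k + 4) \<zeta>" for \<zeta>
  proof -
    have "k + 1 + 4 = k + 5" "k - 1 + 4 = k + 3" by simp_all
    then show ?thesis
      using \<Psi>_recurrence[of k "\<zeta> - 2 * pi * \<i>"] unfolding \<Psi>_translate by (simp only: vector_smult_assoc)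
  qed
  then have "multiplier \<theta>\<^sub>i k *s (multiplier \<theta>\<^sub>i (k + 1) *s \<Psi> (k + 5) \<zeta>) =
      multiplier \<theta>\<^sub>i k *s (multiplier \<theta>\<^sub>i (k - 1) *s \<Psi> (k + 3) \<zeta> + (s k * multiplier \<theta>\<^sub>i k) *s \<Psi> (k + 4) \<zeta>)" for \<zeta>
    by simp
  moreover have "multiplier \<theta>\<^sub>i k * multiplier \<theta>\<^sub>i (k + 1) = 1" "multiplier \<theta>\<^sub>i k * multiplier \<theta>\<^sub>i (k - 1) = 1"
    by (simp_all add: multiplier_def)
  ultimately have "\<Psi> (k + 5) \<zeta> = \<Psi> (k + 3) \<zeta> + (s k * multiplier \<theta>\<^sub>i k ^ 2) *s \<Psi> (k + 4) \<zeta>" for \<zeta>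
    by (simp add: vector_add_ldistrib power2_eq_square mult_ac)
  moreover have "\<Psi> (k + 5) \<zeta> = \<Psi> (k + 3) \<zeta> + s (k + 4) *s \<Psi> (k + 4) \<zeta>" for \<zeta>
  proof -
    have "k + 4 + 1 = k + 5" "k + 4 - 1 = k + 3" by simp_all
    then show ?thesis
      using \<Psi>_recurrence[of "k + 4" \<zeta>] by (simp only:)
  qed
  ultimately have "1 *s \<Psi> (k + 3) 0 + s (k + 4) *s \<Psi> (k + 3 + 1) 0 =
      1 *s \<Psi> (k + 3) 0 + (s k * multiplier \<theta>\<^sub>i k ^ 2) *s \<Psi> (k + 3 + 1) 0"
    by (simp add: add.assoc)
  then show ?thesis
    unfolding \<Psi>_independent by simp
qed

section \<open>The three quantisation conditions in terms of Stokes multipliers\<close>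

lemma quantisation_1: "(\<forall>\<zeta>. \<Psi> (k + 1) \<zeta> = c *s \<Psi> (k - 1) \<zeta>) \<longleftrightarrow> s k = 0 \<and> c = 1"
proof -
  have "\<Psi> (k + 1) \<zeta> = c *s \<Psi> (k - 1) \<zeta> \<longleftrightarrow>
      1 *s \<Psi> (k - 1) \<zeta> + s k *s \<Psi> (k - 1 + 1) \<zeta> = c *s \<Psi> (k - 1) \<zeta> + 0 *s \<Psi> (k - 1 + 1) \<zeta>" for \<zeta>
    by (simp add: \<Psi>_recurrence)
  then show ?thesis
    unfolding \<Psi>_independent by auto
qed

lemma quantisation_2:
  "(\<forall>\<zeta>. \<Psi> (k + 2) \<zeta> = c *s \<Psi> (k - 1) \<zeta>) \<longleftrightarrow> 1 + s k * s (k + 1) = 0 \<and> c = s (k + 1)"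
proof -
  have "\<Psi> (k + 2) \<zeta> = c *s \<Psi> (k - 1) \<zeta> \<longleftrightarrow>
      s (k + 1) *s \<Psi> (k - 1) \<zeta> + (1 + s k * s (k + 1)) *s \<Psi> (k - 1 + 1) \<zeta> =
      c *s \<Psi> (k - 1) \<zeta> + 0 *s \<Psi> (k - 1 + 1) \<zeta>" for \<zeta>
    by (simp add: \<Psi>_recurrence_steps(1))
  then show ?thesis
    unfolding \<Psi>_independent by auto
qed

lemma quantisation_3:
  "(\<forall>\<zeta>. \<Psi> k (\<zeta> - 2 * pi * \<i>) = c *s \<Psi> k \<zeta>) \<longleftrightarrow>
    s (k + 1) + s (k + 3) + s (k + 1) * s (k + 2) * s (k + 3) = 0 \<and>
    c = multiplier \<theta>\<^sub>i k * (1 + s (k + 2) * s (k + 3))"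
proof -
  let ?b = "s (k + 1) + s (k + 3) + s (k + 1) * s (k + 2) * s (k + 3)"
  have "\<Psi> k (\<zeta> - 2 * pi * \<i>) = c *s \<Psi> k \<zeta> \<longleftrightarrow>
      (multiplier \<theta>\<^sub>i k * (1 + s (k + 2) * s (k + 3))) *s \<Psi> k \<zeta> + (multiplier \<theta>\<^sub>i k * ?b) *s \<Psi> (k + 1) \<zeta> =
      c *s \<Psi> k \<zeta> + 0 *s \<Psi> (k + 1) \<zeta>" for \<zeta>
    unfolding \<Psi>_translate \<Psi>_recurrence_steps(2) vector_add_ldistrib vector_smult_assoc by simp
  then show ?thesis
    unfolding \<Psi>_independent by auto
qed

lemma quantisation_3_solvable:
  "(\<exists>c. c \<noteq> 0 \<and> (\<forall>\<zeta>. \<Psi> k (\<zeta> - 2 * pi * \<i>) = c *s \<Psi> k \<zeta>)) \<longleftrightarrow>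
    s (k + 1) + s (k + 3) + s (k + 1) * s (k + 2) * s (k + 3) = 0"
proof -
  have "1 + s (k + 2) * s (k + 3) \<noteq> 0"
    if "s (k + 1) + s (k + 3) + s (k + 1) * s (k + 2) * s (k + 3) = 0"
  proof -
    \<comment> \<open>This identity reflects that a product of Stokes matrices has determinant 1; it
      makes the factor \<open>c\<close> automatically nonzero.\<close>
    have "(1 + s (k + 1) * s (k + 2)) * (1 + s (k + 2) * s (k + 3)) =
        1 + s (k + 2) * (s (k + 1) + s (k + 3) + s (k + 1) * s (k + 2) * s (k + 3))"
      by (simp add: algebra_simps)
    with that show ?thesis by auto
  qed
  then show ?thesis
    unfolding quantisation_3 by auto
qed

lemma quantisation_3_explicit:
  fixes c
  assumes "c \<noteq> 0"
  defines "d \<equiv> exp (2 * pi * \<i> * \<theta>\<^sub>i)" and "Q \<equiv> \<lambda>k. \<forall>\<zeta>. \<Psi> k (\<zeta> - 2 * pi * \<i>) = c *s \<Psi> k \<zeta>"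
  shows "Q 1 \<longleftrightarrow> s 2 + d / c * s 4 = 0 \<and> 1 + s 3 * s 4 = c / d"
    and "Q 2 \<longleftrightarrow> s 3 + d / c * s 1 = 0 \<and> 1 + s 3 * s 4 = 1 / (d * c)"
    and "Q 3 \<longleftrightarrow> s 2 + d * c * s 4 = 0 \<and> 1 + s 1 * s 2 = c / d"
    and "Q 4 \<longleftrightarrow> s 1 + 1 / (d * c) * s 3 = 0 \<and> 1 + s 2 * s 3 = d * c"
proof -
  have "d \<noteq> 0" by (simp add: d_def)
  \<comment> \<open>For k = 2, 3, 4 the condition reaches past s_4, and periodicity brings it back
    to the coordinates of the variety.\<close>
  have s: "s 5 = s 1 * d\<^sup>2" "s 6 = s 2 * (inverse d)\<^sup>2" "s 7 = s 3 * d\<^sup>2"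
    using stokes_multiplier_periodic[of 1] stokes_multiplier_periodic[of 2]
      stokes_multiplier_periodic[of 3]
    by (simp_all add: multiplier_def d_def)
  have m: "multiplier \<theta>\<^sub>i 1 = d" "multiplier \<theta>\<^sub>i 2 = inverse d" "multiplier \<theta>\<^sub>i 3 = d" "multiplier \<theta>\<^sub>i 4 = inverse d"
    by (simp_all add: multiplier_def d_def)
  have Q: "Q k \<longleftrightarrow> s (k + 1) + s (k + 3) + s (k + 1) * s (k + 2) * s (k + 3) = 0 \<and>
      c = multiplier \<theta>\<^sub>i k * (1 + s (k + 2) * s (k + 3))" for k
    unfolding Q_def by (rule quantisation_3)
  have Qk: "Q 1 \<longleftrightarrow> s 2 + s 4 + s 2 * s 3 * s 4 = 0 \<and> c = d * (1 + s 3 * s 4)"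
    "Q 2 \<longleftrightarrow> s 3 + s 5 + s 3 * s 4 * s 5 = 0 \<and> c = inverse d * (1 + s 4 * s 5)"
    "Q 3 \<longleftrightarrow> s 4 + s 6 + s 4 * s 5 * s 6 = 0 \<and> c = d * (1 + s 5 * s 6)"
    "Q 4 \<longleftrightarrow> s 5 + s 7 + s 5 * s 6 * s 7 = 0 \<and> c = inverse d * (1 + s 6 * s 7)"
    using Q[of 1] Q[of 2] Q[of 3] Q[of 4] unfolding m by simp_all
  show "Q 1 \<longleftrightarrow> s 2 + d / c * s 4 = 0 \<and> 1 + s 3 * s 4 = c / d"
    "Q 2 \<longleftrightarrow> s 3 + d / c * s 1 = 0 \<and> 1 + s 3 * s 4 = 1 / (d * c)"
    "Q 3 \<longleftrightarrow> s 2 + d * c * s 4 = 0 \<and> 1 + s 1 * s 2 = c / d"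
    "Q 4 \<longleftrightarrow> s 1 + 1 / (d * c) * s 3 = 0 \<and> 1 + s 2 * s 3 = d * c"
    unfolding Qk s by (rule quantisation_3_lines[OF \<open>c \<noteq> 0\<close> \<open>d \<noteq> 0\<close>])+
qed

lemma monodromy_eigenvalue_\<Psi>:
  assumes "\<theta>\<^sub>0 \<noteq> 0" "a \<noteq> 0 \<or> b \<noteq> 0"
    and "\<And>\<zeta>. a *s \<Psi> k (\<zeta> - 2 * pi * \<i>) + b *s \<Psi> (k + 1) (\<zeta> - 2 * pi * \<i>) =
        l *s (a *s \<Psi> k \<zeta> + b *s \<Psi> (k + 1) \<zeta>)"
  shows "l = v_zero \<theta>\<^sub>0 \<or> l = inverse (v_zero \<theta>\<^sub>0)"
proof -
  have "a *s \<Psi> k \<zeta> + b *s \<Psi> (k + 1) \<zeta> \<noteq> 0" for \<zeta>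
    using \<Psi>_independent[of a k \<zeta> b 0 0] assms(2) by auto
  then show ?thesis
    using monodromy_eigenvalue[OF traces residue_eigenvalues \<open>\<theta>\<^sub>0 \<noteq> 0\<close>
        is_solution_add[OF is_solution_smult[OF solution_\<Psi>] is_solution_smult[OF solution_\<Psi>]], of a k b "k + 1" l] assms(3)
    by (simp add: v_zero_def exp_minus)
qed

end

section \<open>Trace of the monodromy and membership in the Stokes variety\<close>

lemma exists_eigenvector_unimodular:
  fixes a b c d :: complex
  assumes det: "a * d - b * c = 1"
  obtains l x y where "x \<noteq> 0 \<or> y \<noteq> 0" "a * x + b * y = l * x" "c * x + d * y = l * y" "l + inverse l = a + d"
proof (cases "c = 0")
  case True
  then have "inverse a = d" using det by (simp add: inverse_unique)
  with True that[of 1 0 a] show ?thesis by simp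
next
  case False
  \<comment> \<open>A root of the characteristic polynomial l^2 - (a + d) l + 1; for nonzero
    \<open>c\<close> the vector (l - d, c) is an eigenvector.\<close>
  define l where "l = (a + d + csqrt ((a + d)\<^sup>2 - 4)) / 2"
  have "2 * l = a + d + csqrt ((a + d)\<^sup>2 - 4)"
    unfolding l_def by simp
  then have "csqrt ((a + d)\<^sup>2 - 4) = 2 * l - (a + d)"
    by simp
  then have "(2 * l - (a + d))\<^sup>2 = (a + d)\<^sup>2 - 4"
    by (metis power2_csqrt)
  then have "4 * (l * (a + d - l) - 1) = 0"
    by algebra
  then have l: "l * (a + d - l) = 1" by simp
  then have "inverse l = a + d - l"
    by (rule inverse_unique)
  moreover have "a * (l - d) + b * c = l * (l - d)"
    using l det by algebra
  moreover have "c * (l - d) + d * c = l * c"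
    by (simp add: algebra_simps)
  ultimately show ?thesis
    using that[of "l - d" c l] False by simp
qed

lemma stokes_data_relation:
  assumes data: "stokes_data \<theta>\<^sub>0 \<theta>\<^sub>i A\<^sub>0 A\<^sub>m t U Y \<Psi> s" and "\<theta>\<^sub>0 \<noteq> 0"
  shows "stokes_relation (exp (2 * pi * \<i> * \<theta>\<^sub>i)) (v_zero \<theta>\<^sub>0 + inverse (v_zero \<theta>\<^sub>0)) (s 1) (s 2) (s 3) (s 4)"
proof -
  define d where "d = exp (2 * pi * \<i> * \<theta>\<^sub>i)"
  have "d \<noteq> 0" by (simp add: d_def)
  \<comment> \<open>The entries of the monodromy matrix in the basis \<Psi>_0, \<Psi>_1. The second
    column comes from \<Psi>_5 after substituting \<Psi>_2 = \<Psi>_0 + s_1 \<Psi>_1.\<close>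
  define a11 where "a11 = inverse d * (1 + s 2 * s 3)"
  define a21 where "a21 = inverse d * (s 1 + s 3 + s 1 * s 2 * s 3)"
  define a12 where "a12 = d * (s 2 + s 4 + s 2 * s 3 * s 4)"
  define a22 where "a22 = d * (1 + s 1 * s 2 + s 1 * s 4 + s 3 * s 4 + s 1 * s 2 * s 3 * s 4)"
  have T0: "\<Psi> 0 (\<zeta> - 2 * pi * \<i>) = a11 *s \<Psi> 0 \<zeta> + a21 *s \<Psi> 1 \<zeta>" for \<zeta>
    using \<Psi>_translate[OF data, of 0 \<zeta>] \<Psi>_recurrence_steps(2)[OF data, of 0 \<zeta>]
    by (simp add: multiplier_def d_def a11_def a21_def vec_eq_iff algebra_simps)
  have T1: "\<Psi> 1 (\<zeta> - 2 * pi * \<i>) = a12 *s \<Psi> 0 \<zeta> + a22 *s \<Psi> 1 \<zeta>" for \<zeta>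
    using \<Psi>_translate[OF data, of 1 \<zeta>] \<Psi>_recurrence_steps(2)[OF data, of 1 \<zeta>] \<Psi>_recurrence[OF data, of 1 \<zeta>]
    by (simp add: multiplier_def d_def a12_def a22_def vec_eq_iff algebra_simps)
  have "a11 * a22 - a12 * a21 = 1"
    using \<open>d \<noteq> 0\<close> by (simp add: a11_def a12_def a21_def a22_def field_simps)
  then obtain l x y where xy: "x \<noteq> 0 \<or> y \<noteq> 0" and e: "a11 * x + a12 * y = l * x" "a21 * x + a22 * y = l * y"
    and l: "l + inverse l = a11 + a22"
    by (rule exists_eigenvector_unimodular)
  have "x *s \<Psi> 0 (\<zeta> - 2 * pi * \<i>) + y *s \<Psi> (0 + 1) (\<zeta> - 2 * pi * \<i>) =
      l *s (x *s \<Psi> 0 \<zeta> + y *s \<Psi> (0 + 1) \<zeta>)" for \<zeta>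
  proof -
    have "x *s \<Psi> 0 (\<zeta> - 2 * pi * \<i>) + y *s \<Psi> 1 (\<zeta> - 2 * pi * \<i>) =
        (a11 * x + a12 * y) *s \<Psi> 0 \<zeta> + (a21 * x + a22 * y) *s \<Psi> 1 \<zeta>"
      unfolding T0 T1 by (simp add: vec_eq_iff algebra_simps)
    then show ?thesis
      unfolding e by (simp add: vec_eq_iff algebra_simps)
  qed
  then have "l = v_zero \<theta>\<^sub>0 \<or> l = inverse (v_zero \<theta>\<^sub>0)"
    using monodromy_eigenvalue_\<Psi>[OF data \<open>\<theta>\<^sub>0 \<noteq> 0\<close> xy] by blast
  then have "l + inverse l = v_zero \<theta>\<^sub>0 + inverse (v_zero \<theta>\<^sub>0)"
    by auto
  then have "d * (v_zero \<theta>\<^sub>0 + inverse (v_zero \<theta>\<^sub>0)) = d * (a11 + a22)"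
    using l by simp
  also have "\<dots> = d\<^sup>2 * (s 1 * s 2 * s 3 * s 4 + s 1 * s 2 + s 1 * s 4 + s 3 * s 4 + 1) + s 2 * s 3 + 1"
    using \<open>d \<noteq> 0\<close> by (simp add: a11_def a22_def field_simps power2_eq_square)
  finally show ?thesis
    unfolding stokes_relation_def d_def[symmetric] by (rule sym)
qed

lemma theta_nonzero:
  assumes "w_param \<theta>\<^sub>0 \<theta>\<^sub>i \<notin> W_sing"
  shows "\<theta>\<^sub>0 \<noteq> 0"
  using w_param_nonsingular(1)[OF assms] by (auto simp: v_zero_def)

lemma stokes_data_mem_variety:
  assumes "stokes_data \<theta>\<^sub>0 \<theta>\<^sub>i A\<^sub>0 A\<^sub>m t U Y \<Psi> s" "w_param \<theta>\<^sub>0 \<theta>\<^sub>i \<notin> W_sing"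
  shows "(s 1, s 2, s 3, s 4) \<in> stokes_variety \<theta>\<^sub>0 \<theta>\<^sub>i"
  using stokes_data_relation[OF assms(1) theta_nonzero[OF assms(2)]] by (simp add: mem_stokes_variety)

text \<open>The condition says that \<Psi>_k itself is an eigenvector of the monodromy, so no
  elimination among the Stokes multipliers is involved.\<close>

lemma quantisation_3_eigenvalue:
  assumes "stokes_data \<theta>\<^sub>0 \<theta>\<^sub>i A\<^sub>0 A\<^sub>m t U Y \<Psi> s" "w_param \<theta>\<^sub>0 \<theta>\<^sub>i \<notin> W_sing"
    and "\<forall>\<zeta>. \<Psi> k (\<zeta> - 2 * pi * \<i>) = c *s \<Psi> k \<zeta>"
  shows "c = v_zero \<theta>\<^sub>0 \<or> c = inverse (v_zero \<theta>\<^sub>0)"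
  using monodromy_eigenvalue_\<Psi>[OF assms(1) theta_nonzero[OF assms(2)], of 1 0 k c] assms(3) by simp

theorem proposition3p20:
  fixes \<theta>\<^sub>0 \<theta>\<^sub>i :: complex
  assumes "w_param \<theta>\<^sub>0 \<theta>\<^sub>i \<notin> W_sing"
  shows "
    (let e = (\<lambda>x::complex. exp (2 * pi * \<i> * x));
         M = stokes_variety \<theta>\<^sub>0 \<theta>\<^sub>i;
         pre = preimage \<theta>\<^sub>0 \<theta>\<^sub>i;
         L = line_L \<theta>\<^sub>0 \<theta>\<^sub>i;
         C = curve_C \<theta>\<^sub>0 \<theta>\<^sub>i
     in
      (pre (L 1) = {(s1, s2, s3, s4). s2 + e (\<theta>\<^sub>i - \<theta>\<^sub>0) * s4 = 0 \<and> 1 + s1 * s2 = e (- (\<theta>\<^sub>i + \<theta>\<^sub>0))} \<and>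
       pre (L 2) = {(s1, s2, s3, s4). s2 + e (\<theta>\<^sub>i + \<theta>\<^sub>0) * s4 = 0 \<and> 1 + s1 * s2 = e (- (\<theta>\<^sub>i - \<theta>\<^sub>0))} \<and>
       pre (L 3) = {(s1, s2, s3, s4). s1 = 0} \<inter> M \<and>
       pre (L 4) = {(s1, s2, s3, s4). s3 + e (\<theta>\<^sub>i - \<theta>\<^sub>0) * s1 = 0 \<and> 1 + s3 * s4 = e (- (\<theta>\<^sub>i + \<theta>\<^sub>0))} \<and>
       pre (L 5) = {(s1, s2, s3, s4). s3 + e (\<theta>\<^sub>i + \<theta>\<^sub>0) * s1 = 0 \<and> 1 + s3 * s4 = e (- (\<theta>\<^sub>i - \<theta>\<^sub>0))} \<and>
       pre (L 6) = {(s1, s2, s3, s4). s4 = 0} \<inter> M \<and>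
       pre (L 7) = {(s1, s2, s3, s4). s1 + e (- (\<theta>\<^sub>i + \<theta>\<^sub>0)) * s3 = 0 \<and> 1 + s2 * s3 = e (\<theta>\<^sub>i + \<theta>\<^sub>0)} \<and>
       pre (L 8) = {(s1, s2, s3, s4). s1 + e (- (\<theta>\<^sub>i - \<theta>\<^sub>0)) * s3 = 0 \<and> 1 + s2 * s3 = e (\<theta>\<^sub>i - \<theta>\<^sub>0)} \<and>
       pre (L 9) = {(s1, s2, s3, s4). s2 = 0} \<inter> M \<and>
       pre (L 10) = {(s1, s2, s3, s4). s2 + e (\<theta>\<^sub>i + \<theta>\<^sub>0) * s4 = 0 \<and> 1 + s3 * s4 = e (- (\<theta>\<^sub>i + \<theta>\<^sub>0))} \<and>
       pre (L 11) = {(s1, s2, s3, s4). s2 + e (\<theta>\<^sub>i - \<theta>\<^sub>0) * s4 = 0 \<and> 1 + s3 * s4 = e (- (\<theta>\<^sub>i - \<theta>\<^sub>0))} \<and>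
       pre (L 12) = {(s1, s2, s3, s4). s3 = 0} \<inter> M)
      \<and>
      (pre (C 1) = {(s1, s2, s3, s4). s1 * s4 + e (- 2 * \<theta>\<^sub>i) = 0} \<inter> M \<and>
       pre (C 2) = {(s1, s2, s3, s4). s1 * s2 + 1 = 0} \<inter> M \<and>
       pre (C 3) = {(s1, s2, s3, s4). s3 * s4 + 1 = 0} \<inter> M \<and>
       pre (C 4) = {(s1, s2, s3, s4). s2 * s3 + 1 = 0} \<inter> M)
      \<and>
      (\<forall>A\<^sub>0 A\<^sub>m t U Y \<Psi> s. stokes_data \<theta>\<^sub>0 \<theta>\<^sub>i A\<^sub>0 A\<^sub>m t U Y \<Psi> s \<longrightarrow>
        (let p = (s 1, s 2, s 3, s 4);
             Q1 = (\<lambda>k c. \<forall>\<zeta>. \<Psi> (k + 1) \<zeta> = c *s \<Psi> (k - 1) \<zeta>);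
             Q2 = (\<lambda>k c. \<forall>\<zeta>. \<Psi> (k + 2) \<zeta> = c *s \<Psi> (k - 1) \<zeta>);
             Q3 = (\<lambda>k c. \<forall>\<zeta>. \<Psi> k (\<zeta> - 2 * pi * \<i>) = c *s \<Psi> k \<zeta>)
         in
          ((\<forall>k. ((\<exists>c. c \<noteq> 0 \<and> Q1 k c) \<longleftrightarrow> s k = 0) \<and>
                (\<forall>c. c \<noteq> 0 \<and> Q1 k c \<longrightarrow> c = 1)) \<and>
           ((\<exists>c. c \<noteq> 0 \<and> Q1 1 c) \<longleftrightarrow> p \<in> pre (L 3)) \<and>
           ((\<exists>c. c \<noteq> 0 \<and> Q1 2 c) \<longleftrightarrow> p \<in> pre (L 9)) \<and>
           ((\<exists>c. c \<noteq> 0 \<and> Q1 3 c) \<longleftrightarrow> p \<in> pre (L 12)) \<and>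
           ((\<exists>c. c \<noteq> 0 \<and> Q1 4 c) \<longleftrightarrow> p \<in> pre (L 6)))
          \<and>
          ((\<forall>k. ((\<exists>c. c \<noteq> 0 \<and> Q2 k c) \<longleftrightarrow> 1 + s k * s (k + 1) = 0) \<and>
                (\<forall>c. c \<noteq> 0 \<and> Q2 k c \<longrightarrow> c = s (k + 1))) \<and>
           ((\<exists>c. c \<noteq> 0 \<and> Q2 1 c) \<longleftrightarrow> p \<in> pre (C 2)) \<and>
           ((\<exists>c. c \<noteq> 0 \<and> Q2 2 c) \<longleftrightarrow> p \<in> pre (C 4)) \<and>
           ((\<exists>c. c \<noteq> 0 \<and> Q2 3 c) \<longleftrightarrow> p \<in> pre (C 3)) \<and>
           ((\<exists>c. c \<noteq> 0 \<and> Q2 4 c) \<longleftrightarrow> p \<in> pre (C 1)))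
          \<and>
          ((\<forall>k. ((\<exists>c. c \<noteq> 0 \<and> Q3 k c) \<longleftrightarrow>
                   s (k + 1) + s (k + 3) + s (k + 1) * s (k + 2) * s (k + 3) = 0) \<and>
                (\<forall>c. c \<noteq> 0 \<and> Q3 k c \<longrightarrow> c = e \<theta>\<^sub>0 \<or> c = e (- \<theta>\<^sub>0))) \<and>
           e \<theta>\<^sub>0 \<noteq> e (- \<theta>\<^sub>0) \<and>
           (Q3 1 (e \<theta>\<^sub>0) \<longleftrightarrow> p \<in> pre (L 11)) \<and>
           (Q3 2 (e \<theta>\<^sub>0) \<longleftrightarrow> p \<in> pre (L 4)) \<and>
           (Q3 3 (e \<theta>\<^sub>0) \<longleftrightarrow> p \<in> pre (L 2)) \<and>
           (Q3 4 (e \<theta>\<^sub>0) \<longleftrightarrow> p \<in> pre (L 7)) \<and>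
           (Q3 1 (e (- \<theta>\<^sub>0)) \<longleftrightarrow> p \<in> pre (L 10)) \<and>
           (Q3 2 (e (- \<theta>\<^sub>0)) \<longleftrightarrow> p \<in> pre (L 5)) \<and>
           (Q3 3 (e (- \<theta>\<^sub>0)) \<longleftrightarrow> p \<in> pre (L 1)) \<and>
           (Q3 4 (e (- \<theta>\<^sub>0)) \<longleftrightarrow> p \<in> pre (L 8))))))"
proof -
  define d v0 where "d = exp (2 * pi * \<i> * \<theta>\<^sub>i)" and "v0 = v_zero \<theta>\<^sub>0"
  define M where "M = stokes_variety \<theta>\<^sub>0 \<theta>\<^sub>i"
  have v0: "v0 \<noteq> 0" "inverse v0 \<noteq> 0" "v0 \<noteq> inverse v0"
    using w_param_nonsingular(1)[OF assms] by (simp_all add: v0_def v_zero_def)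
  have ratios: "d / inverse v0 = d * v0" "inverse v0 / d = 1 / (d * v0)" "1 / (d / v0) = v0 / d"
    "d * inverse v0 = d / v0"
    by (simp_all add: field_simps)
  have exp_\<theta>\<^sub>0: "exp (2 * pi * \<i> * \<theta>\<^sub>0) = v0" "exp (2 * pi * \<i> * (- \<theta>\<^sub>0)) = inverse v0"
    by (simp_all add: v0_def v_zero_def exp_minus)
  have exp_double: "exp (2 * pi * \<i> * (- 2 * \<theta>\<^sub>i)) = 1 / d\<^sup>2"
    unfolding d_def by (simp add: exp_minus divide_inverse flip: exp_double)
  note exps = exp_\<theta>\<^sub>0 exp_double exp_parameters[of \<theta>\<^sub>i \<theta>\<^sub>0, folded d_def v0_def]
  note lines = preimage_line_L[OF assms, folded d_def v0_def M_def]
  note curves = preimage_curves[of \<theta>\<^sub>0 \<theta>\<^sub>i, folded d_def M_def]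
  show ?thesis
    unfolding Let_def exps lines curves M_def[symmetric]
  proof (intro conjI refl, intro allI impI, goal_cases)
    case (1 A\<^sub>0 A\<^sub>m t U Y \<Psi> s)
    note data = this
    note q3 = quantisation_3_explicit[OF data, folded d_def]
    note quantisation = quantisation_1[OF data] quantisation_2[OF data]
      quantisation_3_solvable[OF data] q3[OF v0(1)] q3[OF v0(2), unfolded ratios]
    have mem: "(s 1, s 2, s 3, s 4) \<in> M"
      unfolding M_def by (rule stokes_data_mem_variety[OF data assms])
    \<comment> \<open>The second condition for k = 4 involves s_5, and d^2 is what makes it the
      equation of C_1.\<close>
    have "s 5 = s 1 * d\<^sup>2"
      using stokes_multiplier_periodic[OF data, of 1] by (simp add: multiplier_def d_def)
    then have curve_1: "s 1 * s 4 + 1 / d\<^sup>2 = 0 \<longleftrightarrow> 1 + s 4 * s 5 = 0"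
      by (simp add: d_def field_simps)
    have eigenvalue: "c = v0 \<or> c = inverse v0"
      if "c \<noteq> 0 \<and> (\<forall>\<zeta>. \<Psi> k (\<zeta> - 2 * pi * \<i>) = c *s \<Psi> k \<zeta>)" for k c
      unfolding v0_def using quantisation_3_eigenvalue[OF data assms] that by blast
    show ?case
      unfolding quantisation using mem v0(3) eigenvalue
      by (intro conjI) (auto simp: curve_1
        add.commute[of "s 1 * s 2" 1] add.commute[of "s 2 * s 3" 1] add.commute[of "s 3 * s 4" 1])
  qed
qed

end
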